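(* Let $m\leq 4$ and let $\mathcal F$ be a $(0,0)$-eigenfamily of maps (not necessarily polynomials) $\mathbb{R}^m\to\mathbb{C}$. Then $\mathcal F$ is uniformly of complex type.
   Context: A family $\mathcal F$ of smooth functions $\mathbb{R}^m\to\mathbb{C}$ (defined on all of $\mathbb{R}^m$) is a $(0,0)$-eigenfamily if for all $F,G\in\mathcal F$ and all $x\in\mathbb{R}^m$: $\Delta F=0$ and $(\nabla_xF)^T\nabla_xG=0$. Here $\Delta$ is the Euclidean Laplacian, $\nabla_xF=\nabla_x\operatorname{Re}F+i\nabla_x\operatorname{Im}F\in\mathbb{C}^m$ is the Euclidean gradient, and $v^Tw=\sum_jv_jw_j$ is the complex bilinear pairing (no conjugation). A family $\mathcal F$ of functions $\mathbb{R}^m\to\mathbb{C}$ is uniformly of complex type if there are $k\geq 0$, an orthogonal projection $\pi:\mathbb{R}^m\to\mathbb{C}^k$ (i.e. the adjoint of an isometric $\mathbb{R}$-linear embedding $\mathbb{C}^k\cong\mathbb{R}^{2k}\to\mathbb{R}^m$), and a family $\mathcal G$ of holomorphic maps $\mathbb{C}^k\to\mathbb{C}$ so that $\mathcal F=\{G\circ\pi\mid G\in\mathcal G\}$. *)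

theory Defs
  imports "HOL-Analysis.Analysis"
begin

definition partial_deriv :: "'m \<Rightarrow> (real^'m \<Rightarrow> 'b) \<Rightarrow> real^'m \<Rightarrow> 'b::real_normed_vector" where
  "partial_deriv i F x = frechet_derivative F (at x) (axis i 1)"

primrec times_cont_diff :: "nat \<Rightarrow> (real^'m \<Rightarrow> 'b::real_normed_vector) \<Rightarrow> bool" where
  "times_cont_diff 0 F \<longleftrightarrow> continuous_on UNIV F"
| "times_cont_diff (Suc n) F \<longleftrightarrow>
     (\<forall>x. F differentiable (at x)) \<and> (\<forall>i. times_cont_diff n (partial_deriv i F))"

definition smooth :: "(real^'m \<Rightarrow> 'b::real_normed_vector) \<Rightarrow> bool" where
  "smooth F \<longleftrightarrow> (\<forall>n. times_cont_diff n F)"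

definition laplacian :: "(real^'m \<Rightarrow> complex) \<Rightarrow> real^'m \<Rightarrow> complex" where
  "laplacian F x = (\<Sum>i\<in>UNIV. partial_deriv i (partial_deriv i F) x)"

definition gradient :: "(real^'m \<Rightarrow> real) \<Rightarrow> real^'m \<Rightarrow> real^'m" where
  "gradient f x = (\<chi> i. partial_deriv i f x)"

definition complex_gradient :: "(real^'m \<Rightarrow> complex) \<Rightarrow> real^'m \<Rightarrow> complex^'m" where
  "complex_gradient F x =
     (\<chi> i. complex_of_real (gradient (\<lambda>y. Re (F y)) x $ i)
           + \<i> * complex_of_real (gradient (\<lambda>y. Im (F y)) x $ i))"

(* No conjugation, so this is not the inner product of the euclidean space complex^'m. *)
definition bilinear_pairing :: "complex^'m \<Rightarrow> complex^'m \<Rightarrow> complex" where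
  "bilinear_pairing v w = (\<Sum>j\<in>UNIV. v $ j * w $ j)"

definition zero_zero_eigenfamily :: "(real^'m \<Rightarrow> complex) set \<Rightarrow> bool" where
  "zero_zero_eigenfamily \<F> \<longleftrightarrow>
     (\<forall>F\<in>\<F>. smooth F) \<and>
     (\<forall>F\<in>\<F>. \<forall>G\<in>\<F>. \<forall>x. laplacian F x = 0 \<and>
        bilinear_pairing (complex_gradient F x) (complex_gradient G x) = 0)"

(* The dimension k is quantified inside the main definition, so it cannot be a type: C^k consists of
   the sequences of complex numbers supported on {..<k}. *)
definition complex_space :: "nat \<Rightarrow> (nat \<Rightarrow> complex) set" where
  "complex_space k = {z. \<forall>j\<ge>k. z j = 0}"

definition complex_space_norm :: "nat \<Rightarrow> (nat \<Rightarrow> complex) \<Rightarrow> real" where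
  "complex_space_norm k z = L2_set (\<lambda>j. cmod (z j)) {..<k}"

(* The real inner product of C^k = R^(2k); the summands use the real inner product of the
   library on complex numbers, Re a * Re b + Im a * Im b. *)
definition complex_space_inner :: "nat \<Rightarrow> (nat \<Rightarrow> complex) \<Rightarrow> (nat \<Rightarrow> complex) \<Rightarrow> real" where
  "complex_space_inner k z w = (\<Sum>j<k. z j \<bullet> w j)"

definition isometric_linear_embedding :: "nat \<Rightarrow> ((nat \<Rightarrow> complex) \<Rightarrow> real^'m) \<Rightarrow> bool" where
  "isometric_linear_embedding k \<iota> \<longleftrightarrow>
     (\<forall>z\<in>complex_space k. \<forall>w\<in>complex_space k. \<iota> (\<lambda>j. z j + w j) = \<iota> z + \<iota> w) \<and>
     (\<forall>c::real. \<forall>z\<in>complex_space k. \<iota> (\<lambda>j. c *\<^sub>R z j) = c *\<^sub>R \<iota> z) \<and>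
     (\<forall>z\<in>complex_space k. norm (\<iota> z) = complex_space_norm k z)"

definition orthogonal_projection :: "nat \<Rightarrow> (real^'m \<Rightarrow> nat \<Rightarrow> complex) \<Rightarrow> bool" where
  "orthogonal_projection k \<pi> \<longleftrightarrow>
     (\<forall>x. \<pi> x \<in> complex_space k) \<and>
     (\<exists>\<iota>. isometric_linear_embedding k \<iota> \<and>
        (\<forall>x. \<forall>z\<in>complex_space k. complex_space_inner k (\<pi> x) z = x \<bullet> \<iota> z))"

(* Complex Frechet differentiability at every point of C^k, with complex-linear derivative
   h \<mapsto> (\<Sum>j<k. a j * h j); values of G outside C^k are irrelevant. *)
definition holomorphic_map :: "nat \<Rightarrow> ((nat \<Rightarrow> complex) \<Rightarrow> complex) \<Rightarrow> bool" where
  "holomorphic_map k G \<longleftrightarrow>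
     (\<forall>z\<in>complex_space k. \<exists>a::nat \<Rightarrow> complex. \<forall>\<epsilon>>0. \<exists>\<delta>>0. \<forall>h\<in>complex_space k.
        complex_space_norm k h < \<delta> \<longrightarrow>
        cmod (G (\<lambda>j. z j + h j) - G z - (\<Sum>j<k. a j * h j)) \<le> \<epsilon> * complex_space_norm k h)"

definition uniformly_of_complex_type :: "(real^'m \<Rightarrow> complex) set \<Rightarrow> bool" where
  "uniformly_of_complex_type \<F> \<longleftrightarrow>
     (\<exists>k \<pi> \<G>. orthogonal_projection k \<pi> \<and> (\<forall>G\<in>\<G>. holomorphic_map k G) \<and>
        \<F> = {G \<circ> \<pi> | G. G \<in> \<G>})"

end

(* The gradient p of an eigenfunction F is isotropic.  Differentiating the eikonal equation and using
   harmonicity shows that the Hessian of F vanishes on one of the two null planes of C^4 that contain p;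
   on an open set F is then formally constant along one of the two families of null planes.
   Harmonic functions on R^m extend to entire functions on C^m, so F is genuinely constant along these
   planes, and two planes of the same family with different slopes meet in a point of C^4.  Hence
   F x = F y unless the gradients at x and y are orthogonal, which forces all gradients of F to be
   mutually orthogonal for the complex bilinear pairing.  Applying this to F + G and F + F G shows the
   same for the gradients of the whole family.  Their complex span is an isotropic subspace, which is
   the same datum as a projection to some C^k through which every F factors holomorphically. *)

theory Submission
  imports Defs
begin

subsection \<open>Smooth functions\<close>

text \<open>For m = 4 a complex null plane through a point of R^m contains no other real point, so
  constancy of F along it is expressed by a jet: all iterated derivatives at that point in
  directions of the plane vanish. The point where two planes meet may lie arbitrarily far from R^m,
  so a positive radius of convergence is not enough; harmonicity on all of R^m makes the Taylor
  series converge everywhere. The extension to C^m is never constructed. Two Taylor polynomials at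
  different real points are compared by moving the base point while the complex target stays fixed,
  which needs only bounds on iterated derivatives; these follow from the maximum principle, without
  integral formulas. The choice between the two families of planes rests on 2 by 2 matrices: in a
  null frame the bilinear square of the gradient is a determinant, and the Laplacian of the eikonal
  equation, combined with its first derivatives, says that a product of two shears is zero. Either
  factor may vanish at some points only, so the argument restricts to an open set and returns by
  unique continuation.\<close>

lemma partial_derivI:
  assumes "(F has_derivative F') (at x)"
  shows "partial_deriv i F x = F' (axis i 1)"
  using assms unfolding partial_deriv_def by (simp add: frechet_derivative_at[symmetric])

lemma frechet_eq_sum_partial:
  fixes F :: "real^'m \<Rightarrow> 'b::real_normed_vector"
  assumes "F differentiable (at x)"
  shows "frechet_derivative F (at x) h = (\<Sum>i\<in>UNIV. h $ i *\<^sub>R partial_deriv i F x)"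
proof -
  interpret bounded_linear "frechet_derivative F (at x)"
    using assms frechet_derivative_works has_derivative_bounded_linear by blast
  have "frechet_derivative F (at x) h = frechet_derivative F (at x) (\<Sum>i\<in>UNIV. h $ i *\<^sub>R axis i 1)"
    by (simp add: basis_expansion[of h, unfolded scalar_mult_eq_scaleR])
  also have "\<dots> = (\<Sum>i\<in>UNIV. h $ i *\<^sub>R partial_deriv i F x)"
    by (simp add: sum scaleR partial_deriv_def)
  finally show ?thesis .
qed

lemma has_derivative_sum_partial:
  fixes F :: "real^'m \<Rightarrow> 'b::real_normed_vector"
  assumes "F differentiable (at x)"
  shows "(F has_derivative (\<lambda>h. \<Sum>i\<in>UNIV. h $ i *\<^sub>R partial_deriv i F x)) (at x)"
proof -
  have "frechet_derivative F (at x) = (\<lambda>h. \<Sum>i\<in>UNIV. h $ i *\<^sub>R partial_deriv i F x)"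
    using frechet_eq_sum_partial[OF assms] by blast
  then show ?thesis
    using assms frechet_derivative_works by metis
qed

lemma times_cont_diff_continuous:
  "times_cont_diff n F \<Longrightarrow> continuous_on UNIV F"
  by (cases n) (auto intro!: continuous_at_imp_continuous_on differentiable_imp_continuous_within)

lemma times_cont_diff_mono:
  "times_cont_diff (Suc n) F \<Longrightarrow> times_cont_diff n F"
proof (induction n arbitrary: F)
  case 0
  then show ?case using times_cont_diff_continuous[OF 0] by simp
next
  case (Suc n)
  then show ?case unfolding times_cont_diff.simps(2)[of "Suc n"] times_cont_diff.simps(2)[of n] by blast
qed

lemma smooth_differentiable: "smooth F \<Longrightarrow> F differentiable (at x)"
  unfolding smooth_def using times_cont_diff.simps(2)[of 0 F] by blast

lemma smooth_partial: "smooth F \<Longrightarrow> smooth (partial_deriv i F)"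
  unfolding smooth_def using times_cont_diff.simps(2)[of _ F] by blast

lemma smooth_continuous: "smooth F \<Longrightarrow> continuous_on S F"
  unfolding smooth_def using times_cont_diff_continuous continuous_on_subset by blast

lemma partial_linear:
  assumes "bounded_linear L" "F differentiable (at x)"
  shows "partial_deriv i (\<lambda>x. L (F x)) x = L (partial_deriv i F x)"
  using partial_derivI[OF bounded_linear.has_derivative[OF assms(1)
      iffD1[OF frechet_derivative_works assms(2)]]]
  by (simp add: partial_deriv_def)

lemma partial_add:
  assumes "F differentiable (at x)" "G differentiable (at x)"
  shows "partial_deriv i (\<lambda>x. F x + G x) x = partial_deriv i F x + partial_deriv i G x"
  using partial_derivI[OF has_derivative_add[OF assms[unfolded frechet_derivative_works]]]
  by (simp add: partial_deriv_def)

lemma partial_mult: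
  fixes F G :: "real^'m \<Rightarrow> 'b::real_normed_algebra"
  assumes "F differentiable (at x)" "G differentiable (at x)"
  shows "partial_deriv i (\<lambda>x. F x * G x) x = F x * partial_deriv i G x + partial_deriv i F x * G x"
  using partial_derivI[OF has_derivative_mult[OF assms[unfolded frechet_derivative_works]]]
  by (simp add: partial_deriv_def)

lemma partial_const [simp]: "partial_deriv i (\<lambda>x. c) = (\<lambda>x. 0)"
  by (rule ext, rule partial_derivI) (rule has_derivative_const)

lemma times_cont_diff_const: "times_cont_diff n (\<lambda>x. c)"
  by (induction n arbitrary: c) auto

lemma times_cont_diff_linear:
  assumes "bounded_linear L"
  shows "times_cont_diff n F \<Longrightarrow> times_cont_diff n (\<lambda>x. L (F x))"
proof (induction n arbitrary: F)
  case 0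
  then show ?case by (auto intro: bounded_linear.continuous_on[OF assms])
next
  case (Suc n)
  have "(\<lambda>x. L (F x)) differentiable (at x)" for x
    by (rule differentiable_compose[of L, OF bounded_linear_imp_differentiable[OF assms]])
       (use Suc.prems in simp)
  moreover have "partial_deriv i (\<lambda>x. L (F x)) = (\<lambda>x. L (partial_deriv i F x))" for i
    using Suc.prems by (auto intro!: ext partial_linear assms)
  ultimately show ?case using Suc by simp
qed

lemma times_cont_diff_add:
  "times_cont_diff n F \<Longrightarrow> times_cont_diff n G \<Longrightarrow> times_cont_diff n (\<lambda>x. F x + G x)"
proof (induction n arbitrary: F G)
  case 0
  then show ?case by (auto intro: continuous_on_add)
next
  case (Suc n)
  then have "partial_deriv i (\<lambda>x. F x + G x) = (\<lambda>x. partial_deriv i F x + partial_deriv i G x)" for i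
    by (auto intro!: ext partial_add)
  then show ?case using Suc by simp
qed

lemma times_cont_diff_mult:
  fixes F G :: "real^'m \<Rightarrow> 'b::real_normed_algebra"
  shows "times_cont_diff n F \<Longrightarrow> times_cont_diff n G \<Longrightarrow> times_cont_diff n (\<lambda>x. F x * G x)"
proof (induction n arbitrary: F G)
  case 0
  then show ?case by (auto intro: continuous_on_mult)
next
  case (Suc n)
  then have "partial_deriv i (\<lambda>x. F x * G x)
      = (\<lambda>x. F x * partial_deriv i G x + partial_deriv i F x * G x)" for i
    by (auto intro!: ext partial_mult)
  moreover have "times_cont_diff n F" "times_cont_diff n G"
    using Suc.prems times_cont_diff_mono by blast+
  ultimately show ?case using Suc by (simp add: times_cont_diff_add)
qed

lemma smooth_const [simp]: "smooth (\<lambda>x. c)"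
  by (simp add: smooth_def times_cont_diff_const)

lemma smooth_linear: "bounded_linear L \<Longrightarrow> smooth F \<Longrightarrow> smooth (\<lambda>x. L (F x))"
  by (simp add: smooth_def times_cont_diff_linear)

lemma smooth_add: "smooth F \<Longrightarrow> smooth G \<Longrightarrow> smooth (\<lambda>x. F x + G x)"
  by (simp add: smooth_def times_cont_diff_add)

lemma smooth_mult:
  fixes F G :: "real^'m \<Rightarrow> 'b::real_normed_algebra"
  shows "smooth F \<Longrightarrow> smooth G \<Longrightarrow> smooth (\<lambda>x. F x * G x)"
  by (simp add: smooth_def times_cont_diff_mult)

lemma smooth_minus: "smooth F \<Longrightarrow> smooth (\<lambda>x. - F x)"
  by (rule smooth_linear) (rule bounded_linear_minus[OF bounded_linear_ident])

lemma smooth_diff: "smooth F \<Longrightarrow> smooth G \<Longrightarrow> smooth (\<lambda>x. F x - G x)"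
  using smooth_add[of F "\<lambda>x. - G x"] smooth_minus by auto

lemma smooth_power:
  fixes F :: "real^'m \<Rightarrow> 'b::real_normed_algebra_1"
  shows "smooth F \<Longrightarrow> smooth (\<lambda>x. F x ^ n)"
  by (induction n) (auto intro: smooth_mult)

lemma smooth_sum: "(\<And>i. i \<in> I \<Longrightarrow> smooth (F i)) \<Longrightarrow> smooth (\<lambda>x. \<Sum>i\<in>I. F i x)"
  by (induction I rule: infinite_finite_induct) (auto intro: smooth_add)

lemma smooth_Re: "smooth F \<Longrightarrow> smooth (\<lambda>x. Re (F x))"
  by (rule smooth_linear[OF bounded_linear_Re])

lemma smooth_Im: "smooth F \<Longrightarrow> smooth (\<lambda>x. Im (F x))"
  by (rule smooth_linear[OF bounded_linear_Im])

lemma partial_Re: "smooth F \<Longrightarrow> partial_deriv i (\<lambda>x. Re (F x)) = (\<lambda>x. Re (partial_deriv i F x))"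
  by (intro ext partial_linear bounded_linear_Re smooth_differentiable)

lemma partial_Im: "smooth F \<Longrightarrow> partial_deriv i (\<lambda>x. Im (F x)) = (\<lambda>x. Im (partial_deriv i F x))"
  by (intro ext partial_linear bounded_linear_Im smooth_differentiable)

section \<open>Symmetry of mixed partial derivatives\<close>

lemma partial_line:
  assumes "F differentiable (at (x + t *\<^sub>R axis i 1))"
  shows "((\<lambda>t. F (x + t *\<^sub>R axis i 1)) has_vector_derivative
           partial_deriv i F (x + t *\<^sub>R axis i 1)) (at t)"
proof -
  have "((\<lambda>t. F (x + t *\<^sub>R axis i 1)) has_derivative
     (\<lambda>s. frechet_derivative F (at (x + t *\<^sub>R axis i 1)) (s *\<^sub>R axis i 1))) (at t)"
    by (rule has_derivative_compose[of "\<lambda>t. x + t *\<^sub>R axis i 1"])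
       (auto intro!: derivative_eq_intros assms[unfolded frechet_derivative_works])
  moreover have "frechet_derivative F (at (x + t *\<^sub>R axis i 1)) (s *\<^sub>R axis i 1)
      = s *\<^sub>R partial_deriv i F (x + t *\<^sub>R axis i 1)" for s
    using linear_frechet_derivative[OF assms] by (simp add: partial_deriv_def linear_cmul)
  ultimately show ?thesis by (simp add: has_vector_derivative_def)
qed

text \<open>Mean value theorem twice, first in direction \<open>i\<close>, then in direction
  \<open>j\<close>. The left side is symmetric in \<open>i\<close> and \<open>j\<close> while the
  right side records the order of differentiation; this is what lets the two orders be
  compared.\<close>

lemma second_difference:
  fixes u :: "real^'m \<Rightarrow> real"
  assumes "smooth u" "0 < s"
  obtains \<xi> \<eta> where "0 < \<xi>" "\<xi> < s" "0 < \<eta>" "\<eta> < s"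
    "u (x + s *\<^sub>R axis i 1 + s *\<^sub>R axis j 1) - u (x + s *\<^sub>R axis i 1) - u (x + s *\<^sub>R axis j 1) + u x
       = s * s * partial_deriv j (partial_deriv i u) (x + \<xi> *\<^sub>R axis i 1 + \<eta> *\<^sub>R axis j 1)"
proof -
  have line: "((\<lambda>t. v (y + t *\<^sub>R axis k 1)) has_real_derivative
      partial_deriv k v (y + t *\<^sub>R axis k 1)) (at t)" if "smooth v" for v :: "real^'m \<Rightarrow> real" and y t k
    using partial_line[OF smooth_differentiable[OF that]]
    by (simp add: has_real_derivative_iff_has_vector_derivative)
  let ?g = "\<lambda>t. u ((x + s *\<^sub>R axis j 1) + t *\<^sub>R axis i 1) - u (x + t *\<^sub>R axis i 1)"
  let ?g' = "\<lambda>t. partial_deriv i u ((x + s *\<^sub>R axis j 1) + t *\<^sub>R axis i 1)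
        - partial_deriv i u (x + t *\<^sub>R axis i 1)"
  have "\<exists>\<xi>>0. \<xi> < s \<and> ?g s - ?g 0 = (s - 0) * ?g' \<xi>"
    by (intro MVT2 assms(2) DERIV_diff line assms(1))
  then obtain \<xi> where \<xi>: "0 < \<xi>" "\<xi> < s" "?g s - ?g 0 = (s - 0) * ?g' \<xi>"
    by blast
  let ?h = "\<lambda>t. partial_deriv i u ((x + \<xi> *\<^sub>R axis i 1) + t *\<^sub>R axis j 1)"
  let ?h' = "\<lambda>t. partial_deriv j (partial_deriv i u) ((x + \<xi> *\<^sub>R axis i 1) + t *\<^sub>R axis j 1)"
  have "\<exists>\<eta>>0. \<eta> < s \<and> ?h s - ?h 0 = (s - 0) * ?h' \<eta>"
    by (intro MVT2 assms(2) line smooth_partial assms(1))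
  then obtain \<eta> where \<eta>: "0 < \<eta>" "\<eta> < s" "?h s - ?h 0 = (s - 0) * ?h' \<eta>"
    by blast
  show ?thesis
  proof (rule that[OF \<xi>(1,2) \<eta>(1,2)])
    have "u (x + s *\<^sub>R axis i 1 + s *\<^sub>R axis j 1) - u (x + s *\<^sub>R axis i 1) - u (x + s *\<^sub>R axis j 1) + u x
        = ?g s - ?g 0"
      by (simp add: add_ac)
    also have "\<dots> = s * (?h s - ?h 0)"
      unfolding \<xi>(3) by (simp add: add_ac)
    also have "\<dots> = s * s * ?h' \<eta>"
      unfolding \<eta>(3) by simp
    finally show "u (x + s *\<^sub>R axis i 1 + s *\<^sub>R axis j 1) - u (x + s *\<^sub>R axis i 1) - u (x + s *\<^sub>R axis j 1) + u x
        = s * s * ?h' \<eta>" .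
  qed
qed

lemma partial_commute_real:
  fixes u :: "real^'m \<Rightarrow> real"
  assumes "smooth u"
  shows "partial_deriv i (partial_deriv j u) x = partial_deriv j (partial_deriv i u) x"
proof (rule ccontr)
  let ?A = "partial_deriv i (partial_deriv j u)" and ?B = "partial_deriv j (partial_deriv i u)"
  assume ne: "?A x \<noteq> ?B x"
  \<comment> \<open>Half the gap, so that two approximations with error below \<open>e\<close>
    cannot share a value.\<close>
  define e where "e = \<bar>?A x - ?B x\<bar> / 2"
  have "e > 0" using ne by (simp add: e_def)
  have "smooth ?A" "smooth ?B" using assms by (auto intro: smooth_partial)
  then have "isCont ?A x" "isCont ?B x"
    by (metis smooth_continuous continuous_on_eq_continuous_at open_UNIV UNIV_I)+
  then obtain d1 d2 where d: "d1 > 0" "d2 > 0"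
    "\<And>y. dist y x < d1 \<Longrightarrow> dist (?A y) (?A x) < e" "\<And>y. dist y x < d2 \<Longrightarrow> dist (?B y) (?B x) < e"
    using \<open>e > 0\<close> unfolding continuous_at_eps_delta by metis
  define s where "s = min d1 d2 / 2"
  have s: "s > 0" "2 * s \<le> d1" "2 * s \<le> d2" using d by (auto simp: s_def)
  have near: "dist (x + p *\<^sub>R axis k 1 + q *\<^sub>R axis l 1) x < 2 * s"
    if "0 < p" "p < s" "0 < q" "q < s" for p q :: real and k l
  proof -
    have "norm (p *\<^sub>R axis k 1 + q *\<^sub>R axis l (1::real) :: real^'m)
        \<le> norm (p *\<^sub>R axis k (1::real) :: real^'m) + norm (q *\<^sub>R axis l (1::real) :: real^'m)"
      by (rule norm_triangle_ineq)
    also have "\<dots> = p + q" using that by simp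
    finally show ?thesis using that by (simp add: dist_norm add.assoc)
  qed
  obtain p q where 1: "0 < p" "p < s" "0 < q" "q < s"
    "u (x + s *\<^sub>R axis i 1 + s *\<^sub>R axis j 1) - u (x + s *\<^sub>R axis i 1) - u (x + s *\<^sub>R axis j 1) + u x
       = s * s * ?B (x + p *\<^sub>R axis i 1 + q *\<^sub>R axis j 1)"
    using second_difference[OF assms s(1)] by metis
  obtain p' q' where 2: "0 < p'" "p' < s" "0 < q'" "q' < s"
    "u (x + s *\<^sub>R axis j 1 + s *\<^sub>R axis i 1) - u (x + s *\<^sub>R axis j 1) - u (x + s *\<^sub>R axis i 1) + u x
       = s * s * ?A (x + p' *\<^sub>R axis j 1 + q' *\<^sub>R axis i 1)"
    using second_difference[OF assms s(1)] by metis
  have comm: "x + s *\<^sub>R axis j 1 + s *\<^sub>R axis i 1 = x + s *\<^sub>R axis i 1 + s *\<^sub>R axis j 1"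
    by simp
  have "s * s * ?B (x + p *\<^sub>R axis i 1 + q *\<^sub>R axis j 1) = s * s * ?A (x + p' *\<^sub>R axis j 1 + q' *\<^sub>R axis i 1)"
    unfolding 1(5)[symmetric] 2(5)[unfolded comm, symmetric] by (rule arg_cong[of _ _ "\<lambda>r. r + u x"]) simp
  then have "?B (x + p *\<^sub>R axis i 1 + q *\<^sub>R axis j 1) = ?A (x + p' *\<^sub>R axis j 1 + q' *\<^sub>R axis i 1)"
    using s by simp
  moreover have "dist (?B (x + p *\<^sub>R axis i 1 + q *\<^sub>R axis j 1)) (?B x) < e"
    using near[OF 1(1-4)] s by (intro d) (meson order_less_le_trans)
  moreover have "dist (?A (x + p' *\<^sub>R axis j 1 + q' *\<^sub>R axis i 1)) (?A x) < e"
    using near[OF 2(1-4)] s by (intro d) (meson order_less_le_trans)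
  ultimately have "dist (?A x) (?B x) < e + e"
    by (metis dist_commute dist_triangle_less_add)
  then show False by (simp add: e_def dist_real_def)
qed

lemma partial_commute:
  fixes F :: "real^'m \<Rightarrow> complex"
  assumes "smooth F"
  shows "partial_deriv i (partial_deriv j F) x = partial_deriv j (partial_deriv i F) x"
proof (rule complex_eqI)
  show "Re (partial_deriv i (partial_deriv j F) x) = Re (partial_deriv j (partial_deriv i F) x)"
    using partial_commute_real[OF smooth_Re[OF assms], of i j x]
    by (simp add: partial_Re assms smooth_partial)
  show "Im (partial_deriv i (partial_deriv j F) x) = Im (partial_deriv j (partial_deriv i F) x)"
    using partial_commute_real[OF smooth_Im[OF assms], of i j x]
    by (simp add: partial_Im assms smooth_partial)
qed

subsection \<open>Interior gradient estimate for harmonic functions\<close>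

lemma partial_of_linear:
  assumes "bounded_linear L"
  shows "partial_deriv i L = (\<lambda>x. L (axis i 1))"
  by (rule ext, rule partial_derivI) (rule bounded_linear.has_derivative[OF assms has_derivative_ident])

lemma smooth_bounded_linear:
  assumes "bounded_linear L"
  shows "smooth L"
proof -
  have "times_cont_diff n L" for n
    using assms by (cases n) (auto simp: partial_of_linear times_cont_diff_const linear_continuous_on
        bounded_linear_imp_differentiable)
  then show ?thesis by (simp add: smooth_def)
qed

definition sqdist :: "real^'m \<Rightarrow> real^'m \<Rightarrow> real" where
  "sqdist x y = (\<Sum>k\<in>UNIV. (y $ k - x $ k) * (y $ k - x $ k))"

lemma sqdist_dist: "sqdist x y = (dist y x)\<^sup>2"
  by (simp add: sqdist_def dist_norm norm_vec_def L2_set_def sum_nonneg power2_eq_square)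

lemma smooth_coord: "smooth (\<lambda>y::real^'m. y $ k - c)"
  by (intro smooth_diff smooth_const smooth_bounded_linear bounded_linear_vec_nth)

lemma partial_coord: "partial_deriv i (\<lambda>y::real^'m. y $ k - c) x = (if k = i then 1 else 0)"
proof -
  have "((\<lambda>y::real^'m. y $ k - c) has_derivative (\<lambda>h. h $ k)) (at x)"
    by (auto intro!: derivative_eq_intros bounded_linear.has_derivative[OF bounded_linear_vec_nth])
  from partial_derivI[OF this] show ?thesis by (simp add: axis_def)
qed

lemma partial_cmult_coord:
  "partial_deriv i (\<lambda>y::real^'m. c * (y $ k - a)) x = (if k = i then c else 0)"
  unfolding partial_linear[OF bounded_linear_mult_right smooth_differentiable[OF smooth_coord]]
  by (simp add: partial_coord)

lemma smooth_sqdist: "smooth (sqdist x)"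
  unfolding sqdist_def[abs_def] by (intro smooth_sum smooth_mult smooth_coord)

lemma partial_sum:
  assumes "\<And>k. k \<in> I \<Longrightarrow> smooth (F k)"
  shows "partial_deriv i (\<lambda>x. \<Sum>k\<in>I. F k x) x = (\<Sum>k\<in>I. partial_deriv i (F k) x)"
  using assms
  by (induction I rule: infinite_finite_induct)
     (simp_all add: partial_add smooth_differentiable smooth_sum)

lemma partial_sqdist: "partial_deriv i (sqdist x) = (\<lambda>y. 2 * (y $ i - x $ i))"
proof
  fix y
  have "partial_deriv i (sqdist x) y
     = (\<Sum>k\<in>UNIV. partial_deriv i (\<lambda>y. (y $ k - x $ k) * (y $ k - x $ k)) y)"
    unfolding sqdist_def[abs_def] by (intro partial_sum smooth_mult smooth_coord)
  also have "\<dots> = (\<Sum>k\<in>UNIV. if k = i then 2 * (y $ k - x $ k) else 0)"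
    by (intro sum.cong refl)
       (simp add: partial_mult partial_coord smooth_differentiable[OF smooth_coord])
  finally show "partial_deriv i (sqdist x) y = 2 * (y $ i - x $ i)" by simp
qed

definition rlap :: "(real^'m \<Rightarrow> real) \<Rightarrow> real^'m \<Rightarrow> real" where
  "rlap u x = (\<Sum>i\<in>UNIV. partial_deriv i (partial_deriv i u) x)"

lemma partial2_mult:
  fixes F G :: "real^'m \<Rightarrow> 'b::{real_normed_algebra,comm_ring_1}"
  assumes "smooth F" "smooth G"
  shows "partial_deriv i (partial_deriv j (\<lambda>x. F x * G x)) x
    = F x * partial_deriv i (partial_deriv j G) x + partial_deriv i F x * partial_deriv j G x
    + partial_deriv j F x * partial_deriv i G x + partial_deriv i (partial_deriv j F) x * G x"
proof -
  have "partial_deriv j (\<lambda>x. F x * G x) = (\<lambda>x. F x * partial_deriv j G x + partial_deriv j F x * G x)"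
    by (intro ext partial_mult smooth_differentiable assms)
  then show ?thesis
    by (simp add: partial_add partial_mult smooth_differentiable smooth_mult smooth_partial assms)
qed

lemma partial2_add:
  assumes "smooth F" "smooth G"
  shows "partial_deriv i (partial_deriv j (\<lambda>x. F x + G x)) x
    = partial_deriv i (partial_deriv j F) x + partial_deriv i (partial_deriv j G) x"
proof -
  have "partial_deriv j (\<lambda>x. F x + G x) = (\<lambda>x. partial_deriv j F x + partial_deriv j G x)"
    by (intro ext partial_add smooth_differentiable assms)
  then show ?thesis
    by (simp add: partial_add smooth_differentiable smooth_partial assms)
qed

lemma partial2_cmult:
  fixes F :: "real^'m \<Rightarrow> 'b::real_normed_algebra"
  assumes "smooth F"
  shows "partial_deriv i (partial_deriv j (\<lambda>x. c * F x)) x = c * partial_deriv i (partial_deriv j F) x"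
proof -
  have "partial_deriv j (\<lambda>x. c * F x) = (\<lambda>x. c * partial_deriv j F x)"
    by (intro ext partial_linear bounded_linear_mult_right smooth_differentiable assms)
  then show ?thesis
    by (simp add: partial_linear[OF bounded_linear_mult_right] smooth_differentiable smooth_partial assms)
qed

section \<open>Maximum principle for subharmonic functions\<close>

lemma second_partial_at_max:
  fixes v :: "real^'m \<Rightarrow> real"
  assumes v: "smooth v" and d: "d > 0" and max: "\<And>y. dist y z < d \<Longrightarrow> v y \<le> v z"
  shows "partial_deriv i (partial_deriv i v) z \<le> 0"
proof (rule ccontr)
  assume "\<not> partial_deriv i (partial_deriv i v) z \<le> 0"
  then have pos: "partial_deriv i (partial_deriv i v) z > 0" by simp
  let ?l = "\<lambda>t. z + t *\<^sub>R axis i (1::real)"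
  have line: "((\<lambda>t. w (?l t)) has_real_derivative partial_deriv i w (?l t)) (at t)"
    if "smooth w" for w :: "real^'m \<Rightarrow> real" and t
    using partial_line[OF smooth_differentiable[OF that]]
    by (simp add: has_real_derivative_iff_has_vector_derivative)
  have zero: "partial_deriv i v (?l 0) = 0"
  proof (rule DERIV_local_max[OF line[OF v] d], intro allI impI)
    fix t :: real assume "\<bar>0 - t\<bar> < d"
    then show "v (?l t) \<le> v (?l 0)" by (simp add: max dist_norm)
  qed
  obtain e where e: "e > 0" "\<And>t. t > 0 \<Longrightarrow> t < e \<Longrightarrow> partial_deriv i v (?l t) > 0"
    using DERIV_pos_inc_right[OF line[OF smooth_partial[OF v, of i], of 0]] pos zero by auto
  define s where "s = min d e / 2"
  have s: "0 < s" "s < d" "s < e" using d e by (auto simp: s_def)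
  have "\<exists>t>0. t < s \<and> v (?l s) - v (?l 0) = (s - 0) * partial_deriv i v (?l t)"
    by (intro MVT2 s line v)
  then obtain t where "0 < t" "t < s" "v (?l s) - v (?l 0) = s * partial_deriv i v (?l t)" by auto
  then have "v (?l s) > v z" using e(2)[of t] s by (auto simp: algebra_simps mult_pos_pos)
  moreover have "v (?l s) \<le> v z" using s by (intro max) (simp add: dist_norm)
  ultimately show False by simp
qed

lemma max_principle:
  fixes q :: "real^'m \<Rightarrow> real"
  assumes q: "smooth q" and sub: "\<And>y. y \<in> cball x R \<Longrightarrow> rlap q y \<ge> 0"
    and bd: "\<And>y. dist y x = R \<Longrightarrow> q y \<le> M" and R: "R > 0"
  shows "q x \<le> M"
proof (rule ccontr)
  assume "\<not> q x \<le> M"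
  \<comment> \<open>Adding \<open>e * sqdist x y\<close> makes the Laplacian strictly positive;
    \<open>e\<close> is small enough to keep the boundary values below \<open>q x\<close>, so the
    maximum is interior.\<close>
  define e where "e = (q x - M) / (2 * R\<^sup>2)"
  have e: "e > 0" "e * R\<^sup>2 < q x - M"
    using \<open>\<not> q x \<le> M\<close> R by (auto simp: e_def)
  define v where "v = (\<lambda>y. q y + e * sqdist x y)"
  have v: "smooth v"
    unfolding v_def by (intro smooth_add q smooth_mult smooth_const smooth_sqdist)
  obtain z where z: "z \<in> cball x R" "\<And>y. y \<in> cball x R \<Longrightarrow> v y \<le> v z"
    using continuous_attains_sup[of "cball x R" v] R smooth_continuous[OF v] by auto
  have "v x \<le> v z" using z R by simp
  have "dist z x < R"
  proof (rule ccontr)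
    assume "\<not> dist z x < R"
    then have "dist z x = R" using z by (simp add: dist_commute)
    then have "v z \<le> M + e * R\<^sup>2" using bd by (simp add: v_def sqdist_dist)
    moreover have "v x = q x" by (simp add: v_def sqdist_dist)
    ultimately show False using \<open>v x \<le> v z\<close> e by simp
  qed
  have "partial_deriv i (partial_deriv i v) z \<le> 0" for i
  proof (rule second_partial_at_max[OF v])
    show "R - dist z x > 0" using \<open>dist z x < R\<close> by simp
    show "v y \<le> v z" if "dist y z < R - dist z x" for y
      using that dist_triangle[of y x z] by (intro z) (simp add: dist_commute)
  qed
  then have "(\<Sum>i\<in>UNIV. partial_deriv i (partial_deriv i v) z) \<le> 0"
    by (simp add: sum_nonpos)
  moreover have "partial_deriv i (\<lambda>y. 2 * (y $ i - x $ i)) z = 2" for i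
    unfolding partial_cmult_coord by simp
  then have "partial_deriv i (partial_deriv i v) z = partial_deriv i (partial_deriv i q) z + 2 * e" for i
    unfolding v_def
    by (simp add: partial2_add partial2_cmult q smooth_mult smooth_sqdist partial_sqdist)
  then have "(\<Sum>i\<in>UNIV. partial_deriv i (partial_deriv i v) z) = rlap q z + (\<Sum>i::'m\<in>UNIV. 2 * e)"
    by (simp add: rlap_def sum.distrib)
  moreover have "(\<Sum>i::'m\<in>UNIV. 2 * e) > 0" using e by simp
  ultimately show False using sub[OF z(1)] by linarith
qed

text \<open>Bernstein's method: with the cut-off \<open>\<eta> = R\<^sup>2 - |y - x|\<^sup>2\<close>, the function
  \<open>\<eta>\<^sup>2 (\<partial>\<^sub>i u)\<^sup>2 + \<lambda> u\<^sup>2\<close> is subharmonic as soon as \<open>\<lambda> \<ge> (2 m + 12) R\<^sup>2\<close>.\<close>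

lemma bernstein_gradient_estimate:
  fixes u :: "real^'m \<Rightarrow> real"
  assumes u: "smooth u" and harm: "\<And>y. rlap u y = 0" and R: "R > 0"
    and M: "\<And>y. y \<in> cball x R \<Longrightarrow> \<bar>u y\<bar> \<le> M"
  shows "R\<^sup>2 * (partial_deriv i u x)\<^sup>2 \<le> (2 * real CARD('m) + 12) * M\<^sup>2"
proof -
  define g where "g = partial_deriv i u"
  define \<eta> where "\<eta> = (\<lambda>y. R\<^sup>2 - sqdist x y)"
  \<comment> \<open>The cut-off costs at most
    \<open>24 * R\<^sup>2 + 4 * real CARD('m) * R\<^sup>2\<close> times the square of
    \<open>g\<close>; this is \<open>2 * l\<close>, the coefficient with which
    \<open>l * u\<^sup>2\<close> contributes the squared gradient of \<open>u\<close>.\<close>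
  define l where "l = (2 * real CARD('m) + 12) * R\<^sup>2"
  define q where "q = (\<lambda>y. (\<eta> y * \<eta> y) * (g y * g y) + l * (u y * u y))"
  have g: "smooth g" unfolding g_def by (intro smooth_partial u)
  have \<eta>: "smooth \<eta>" unfolding \<eta>_def by (intro smooth_diff smooth_const smooth_sqdist)
  have eta1: "partial_deriv k \<eta> = (\<lambda>y. - 2 * (y $ k - x $ k))" for k
  proof
    fix y
    have "partial_deriv k (\<lambda>y. R\<^sup>2 + (-1) * sqdist x y) y = (-1) * (2 * (y $ k - x $ k))"
      by (subst partial_add) (simp_all add: partial_linear[OF bounded_linear_mult_right]
        smooth_differentiable smooth_sqdist smooth_minus partial_sqdist
        partial_linear[OF bounded_linear_minus[OF bounded_linear_ident]])
    then show "partial_deriv k \<eta> y = - 2 * (y $ k - x $ k)" by (simp add: \<eta>_def)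
  qed
  have eta2: "partial_deriv k (partial_deriv k \<eta>) y = - 2" for k y
    unfolding eta1 partial_cmult_coord by simp
  have rg: "(\<Sum>k\<in>UNIV. partial_deriv k (partial_deriv k g) y) = 0" for y
  proof -
    have swap: "partial_deriv k (partial_deriv k g) = partial_deriv i (partial_deriv k (partial_deriv k u))" for k
    proof -
      have "partial_deriv k g = partial_deriv i (partial_deriv k u)"
        unfolding g_def by (intro ext partial_commute_real u)
      then show ?thesis by (auto intro!: partial_commute_real smooth_partial u)
    qed
    have "(\<Sum>k\<in>UNIV. partial_deriv k (partial_deriv k g) y)
        = partial_deriv i (\<lambda>y. \<Sum>k\<in>UNIV. partial_deriv k (partial_deriv k u) y) y"
      unfolding swap by (rule partial_sum[symmetric]) (intro smooth_partial u)
    also have "(\<lambda>y. \<Sum>k\<in>UNIV. partial_deriv k (partial_deriv k u) y) = (\<lambda>y. 0)"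
      using harm by (simp add: rlap_def)
    finally show ?thesis by simp
  qed
  have q2: "partial_deriv k (partial_deriv k q) y
     = (2 * (partial_deriv k \<eta> y)\<^sup>2 - 4 * \<eta> y) * (g y)\<^sup>2
       + 8 * \<eta> y * partial_deriv k \<eta> y * g y * partial_deriv k g y
       + 2 * (\<eta> y)\<^sup>2 * (partial_deriv k g y)\<^sup>2 + 2 * (\<eta> y)\<^sup>2 * g y * partial_deriv k (partial_deriv k g) y
       + 2 * l * (partial_deriv k u y)\<^sup>2 + 2 * l * u y * partial_deriv k (partial_deriv k u) y" for k y
  proof -
    note \<eta>\<eta> = smooth_mult[OF \<eta> \<eta>] and gg = smooth_mult[OF g g] and uu = smooth_mult[OF u u]
    have "partial_deriv k (partial_deriv k q) y
        = partial_deriv k (partial_deriv k (\<lambda>y. \<eta> y * \<eta> y * (g y * g y))) y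
          + l * partial_deriv k (partial_deriv k (\<lambda>y. u y * u y)) y"
      unfolding q_def partial2_add[OF smooth_mult[OF \<eta>\<eta> gg] smooth_mult[OF smooth_const uu]]
        partial2_cmult[OF uu] ..
    also have "\<dots> = (2 * (partial_deriv k \<eta> y)\<^sup>2 - 4 * \<eta> y) * (g y)\<^sup>2
       + 8 * \<eta> y * partial_deriv k \<eta> y * g y * partial_deriv k g y
       + 2 * (\<eta> y)\<^sup>2 * (partial_deriv k g y)\<^sup>2 + 2 * (\<eta> y)\<^sup>2 * g y * partial_deriv k (partial_deriv k g) y
       + 2 * l * (partial_deriv k u y)\<^sup>2 + 2 * l * u y * partial_deriv k (partial_deriv k u) y"
      unfolding partial2_mult[OF \<eta>\<eta> gg] partial2_mult[OF \<eta> \<eta>] partial2_mult[OF g g] partial2_mult[OF u u]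
        partial_mult[OF smooth_differentiable[OF \<eta>] smooth_differentiable[OF \<eta>]]
        partial_mult[OF smooth_differentiable[OF g] smooth_differentiable[OF g]] eta2
      by algebra
    finally show ?thesis .
  qed
  \<comment> \<open>The cut-off vanishes on the sphere, leaving only the \<open>l\<close>-term, and
    equals \<open>R\<^sup>2\<close> at the centre, where the estimate is read off.\<close>
  have "q x \<le> l * M\<^sup>2"
  proof (rule max_principle[OF _ _ _ R])
    show "smooth q" unfolding q_def
      by (intro smooth_add smooth_mult smooth_const \<eta> g u)
    show "q y \<le> l * M\<^sup>2" if "dist y x = R" for y
    proof -
      have "\<bar>u y\<bar> \<le> M" using M that by (simp add: dist_commute)
      then have "(u y)\<^sup>2 \<le> M\<^sup>2" by (metis abs_le_square_iff abs_of_nonneg abs_ge_zero order_trans)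
      moreover have "\<eta> y = 0" by (simp add: \<eta>_def sqdist_dist that)
      ultimately show ?thesis
        by (simp add: q_def power2_eq_square l_def mult_left_mono)
    qed
    show "rlap q y \<ge> 0" if y: "y \<in> cball x R" for y
    proof -
      have lower: "partial_deriv k (partial_deriv k q) y \<ge>
          (- 6 * (partial_deriv k \<eta> y)\<^sup>2 - 4 * \<eta> y) * (g y)\<^sup>2
          + 2 * (\<eta> y)\<^sup>2 * g y * partial_deriv k (partial_deriv k g) y
          + 2 * l * (partial_deriv k u y)\<^sup>2 + 2 * l * u y * partial_deriv k (partial_deriv k u) y" for k
      proof -
        \<comment> \<open>Completing the square absorbs the mixed term of \<open>q2\<close> at the
          price of eight times the square of \<open>partial_deriv k \<eta> y * g y\<close>, which
          turns the coefficient 2 into -6.\<close>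
        have "2 * (\<eta> y * partial_deriv k g y + 2 * partial_deriv k \<eta> y * g y)\<^sup>2 \<ge> 0" by simp
        then show ?thesis unfolding q2 by (simp add: power2_eq_square algebra_simps)
      qed
      have eta_sum: "(\<Sum>k\<in>UNIV. (partial_deriv k \<eta> y)\<^sup>2) = 4 * sqdist x y"
        unfolding eta1 by (simp add: sqdist_def sum_distrib_left power2_eq_square algebra_simps)
      have "(\<Sum>k\<in>UNIV. (- 6 * (partial_deriv k \<eta> y)\<^sup>2 - 4 * \<eta> y) * (g y)\<^sup>2
          + 2 * (\<eta> y)\<^sup>2 * g y * partial_deriv k (partial_deriv k g) y
          + 2 * l * (partial_deriv k u y)\<^sup>2 + 2 * l * u y * partial_deriv k (partial_deriv k u) y)
        = (- 6 * (\<Sum>k\<in>UNIV. (partial_deriv k \<eta> y)\<^sup>2) - real CARD('m) * (4 * \<eta> y)) * (g y)\<^sup>2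
          + 2 * (\<eta> y)\<^sup>2 * g y * (\<Sum>k\<in>UNIV. partial_deriv k (partial_deriv k g) y)
          + 2 * l * (\<Sum>k\<in>UNIV. (partial_deriv k u y)\<^sup>2)
          + 2 * l * u y * (\<Sum>k\<in>UNIV. partial_deriv k (partial_deriv k u) y)"
        by (simp add: sum.distrib sum_subtractf sum_negf sum_distrib_left sum_distrib_right
            left_diff_distrib algebra_simps)
      also have "\<dots> = 2 * l * (\<Sum>k\<in>UNIV. (partial_deriv k u y)\<^sup>2)
          - (24 * sqdist x y + 4 * real CARD('m) * \<eta> y) * (g y)\<^sup>2"
        unfolding rg eta_sum using harm[of y] by (simp add: rlap_def algebra_simps)
      finally have sum: "rlap q y \<ge> 2 * l * (\<Sum>k\<in>UNIV. (partial_deriv k u y)\<^sup>2)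
          - (24 * sqdist x y + 4 * real CARD('m) * \<eta> y) * (g y)\<^sup>2"
        unfolding rlap_def by (rule ord_eq_le_trans[OF sym]) (rule sum_mono, rule lower)
      have "(g y)\<^sup>2 \<le> (\<Sum>k\<in>UNIV. (partial_deriv k u y)\<^sup>2)"
        unfolding g_def by (rule member_le_sum) auto
      then have "2 * l * (g y)\<^sup>2 \<le> 2 * l * (\<Sum>k\<in>UNIV. (partial_deriv k u y)\<^sup>2)"
        by (intro mult_left_mono) (auto simp: l_def)
      moreover have "sqdist x y \<le> R\<^sup>2" "\<eta> y \<le> R\<^sup>2"
        using y R by (auto simp: sqdist_dist \<eta>_def dist_commute intro!: power_mono)
      then have "24 * sqdist x y + 4 * real CARD('m) * \<eta> y \<le> 24 * R\<^sup>2 + 4 * real CARD('m) * R\<^sup>2"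
        by (intro add_mono mult_left_mono) auto
      then have "(24 * sqdist x y + 4 * real CARD('m) * \<eta> y) * (g y)\<^sup>2 \<le> 2 * l * (g y)\<^sup>2"
        by (intro mult_right_mono) (auto simp: l_def algebra_simps)
      ultimately show ?thesis using sum by linarith
    qed
  qed
  moreover have "q x = R\<^sup>2 * (R\<^sup>2 * (g x)\<^sup>2) + l * (u x)\<^sup>2"
    by (simp add: q_def \<eta>_def sqdist_dist power2_eq_square)
  moreover have "l * (u x)\<^sup>2 \<ge> 0" by (simp add: l_def)
  ultimately have "R\<^sup>2 * (R\<^sup>2 * (g x)\<^sup>2) \<le> l * M\<^sup>2"
    by linarith
  then have "R\<^sup>2 * (R\<^sup>2 * (g x)\<^sup>2) \<le> R\<^sup>2 * ((2 * real CARD('m) + 12) * M\<^sup>2)"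
    by (simp add: l_def mult.commute mult.left_commute)
  then show ?thesis unfolding g_def by (rule mult_left_le_imp_le) (use R in simp)
qed

subsection \<open>Derivatives in complex directions\<close>

definition dderiv :: "complex^'m \<Rightarrow> (real^'m \<Rightarrow> complex) \<Rightarrow> real^'m \<Rightarrow> complex" where
  "dderiv w F x = (\<Sum>i\<in>UNIV. w $ i * partial_deriv i F x)"

definition cvec :: "real^'m \<Rightarrow> complex^'m" where
  "cvec h = (\<chi> i. complex_of_real (h $ i))"

lemma smooth_dderiv: "smooth F \<Longrightarrow> smooth (dderiv w F)"
  unfolding dderiv_def[abs_def] by (intro smooth_sum smooth_mult smooth_const smooth_partial)

lemma smooth_dderiv_pow: "smooth F \<Longrightarrow> smooth ((dderiv w ^^ n) F)"
  by (induction n) (auto intro: smooth_dderiv)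

lemma partial_cmult:
  fixes F :: "real^'m \<Rightarrow> complex"
  shows "smooth F \<Longrightarrow> partial_deriv i (\<lambda>x. c * F x) x = c * partial_deriv i F x"
  by (intro partial_linear bounded_linear_mult_right smooth_differentiable)

lemma partial_dderiv:
  assumes "smooth F"
  shows "partial_deriv i (dderiv w F) = dderiv w (partial_deriv i F)"
proof
  fix x
  have "partial_deriv i (dderiv w F) x = (\<Sum>j\<in>UNIV. partial_deriv i (\<lambda>x. w $ j * partial_deriv j F x) x)"
    unfolding dderiv_def[abs_def] by (intro partial_sum smooth_mult smooth_const smooth_partial assms)
  also have "\<dots> = dderiv w (partial_deriv i F) x"
    unfolding dderiv_def
    by (intro sum.cong refl) (simp add: partial_cmult smooth_partial assms partial_commute[of F i])
  finally show "partial_deriv i (dderiv w F) x = dderiv w (partial_deriv i F) x" .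
qed

lemma dderiv_commute:
  assumes "smooth F"
  shows "dderiv v (dderiv w F) = dderiv w (dderiv v F)"
proof
  fix x
  have "dderiv v (dderiv w F) x
      = (\<Sum>i\<in>UNIV. \<Sum>j\<in>UNIV. w $ j * (v $ i * partial_deriv i (partial_deriv j F) x))"
    by (simp add: dderiv_def[of v] partial_dderiv assms)
       (simp add: dderiv_def partial_commute[OF assms] sum_distrib_left mult_ac)
  also have "\<dots> = dderiv w (dderiv v F) x"
    by (subst sum.swap) (simp add: dderiv_def[of w] partial_dderiv assms,
      simp add: dderiv_def partial_commute[OF assms] sum_distrib_left mult_ac)
  finally show "dderiv v (dderiv w F) x = dderiv w (dderiv v F) x" .
qed

lemma dderiv_add_dir: "dderiv (v + w) F x = dderiv v F x + dderiv w F x"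
  by (simp add: dderiv_def sum.distrib distrib_right)

lemma dderiv_scale_dir: "dderiv (c *s w) F x = c * dderiv w F x"
  by (simp add: dderiv_def sum_distrib_left mult_ac)

lemma dderiv_diff_dir: "dderiv (v - w) F x = dderiv v F x - dderiv w F x"
  by (simp add: dderiv_def sum_subtractf left_diff_distrib)

lemma dderiv_zero_dir [simp]: "dderiv 0 F = (\<lambda>x. 0)"
  by (simp add: dderiv_def fun_eq_iff)

lemma dderiv_const [simp]: "dderiv w (\<lambda>x. c) = (\<lambda>x. 0)"
  by (simp add: dderiv_def fun_eq_iff)

lemma dderiv_add:
  "smooth F \<Longrightarrow> smooth G \<Longrightarrow> dderiv w (\<lambda>x. F x + G x) x = dderiv w F x + dderiv w G x"
  by (simp add: dderiv_def partial_add smooth_differentiable sum.distrib distrib_left)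

lemma dderiv_cmult: "smooth F \<Longrightarrow> dderiv w (\<lambda>x. c * F x) x = c * dderiv w F x"
  by (simp add: dderiv_def partial_cmult sum_distrib_left mult_ac)

lemma dderiv_mult:
  "smooth F \<Longrightarrow> smooth G \<Longrightarrow> dderiv w (\<lambda>x. F x * G x) x = F x * dderiv w G x + dderiv w F x * G x"
  by (simp add: dderiv_def partial_mult smooth_differentiable sum.distrib sum_distrib_left
      sum_distrib_right algebra_simps)

lemma dderiv_diff:
  assumes "smooth F" "smooth G"
  shows "dderiv w (\<lambda>x. F x - G x) x = dderiv w F x - dderiv w G x"
  using dderiv_add[OF assms(1) smooth_mult[OF smooth_const assms(2)], of w "-1" x]
    dderiv_cmult[OF assms(2), of w "-1" x] by simp

lemma dderiv_cong_ev:
  assumes "open U" "x \<in> U" "\<And>y. y \<in> U \<Longrightarrow> F y = G y"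
  shows "dderiv w F x = dderiv w G x"
proof -
  have "(F has_derivative F') (at x) \<longleftrightarrow> (G has_derivative F') (at x)" for F'
    using assms by (metis has_derivative_transform_within_open)
  then have "partial_deriv i F x = partial_deriv i G x" for i
    by (simp add: partial_deriv_def frechet_derivative_def)
  then show ?thesis by (simp add: dderiv_def)
qed

lemma dderiv_pow_linear:
  assumes "smooth F" "smooth G"
  shows "(dderiv w ^^ n) (\<lambda>x. F x - c * G x) = (\<lambda>x. (dderiv w ^^ n) F x - c * (dderiv w ^^ n) G x)"
  by (induction n)
     (auto simp: dderiv_diff dderiv_cmult smooth_mult smooth_dderiv_pow assms)

lemma dderiv_line:
  assumes "smooth F"
  shows "((\<lambda>t. F (y + t *\<^sub>R h)) has_vector_derivative dderiv (cvec h) F (y + t *\<^sub>R h)) (at t)"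
proof -
  have "((\<lambda>t. F (y + t *\<^sub>R h)) has_derivative
     (\<lambda>s. \<Sum>i\<in>UNIV. (s *\<^sub>R h) $ i *\<^sub>R partial_deriv i F (y + t *\<^sub>R h))) (at t)"
    by (rule has_derivative_compose[of "\<lambda>t. y + t *\<^sub>R h", OF _ has_derivative_sum_partial])
       (auto intro!: derivative_eq_intros smooth_differentiable assms)
  then show ?thesis
    by (simp add: has_vector_derivative_def dderiv_def cvec_def scaleR_conv_of_real[where 'a = complex]
        sum_distrib_left mult.assoc)
qed

section \<open>Harmonic functions and bounds on iterated derivatives\<close>

definition harmonic :: "(real^'m \<Rightarrow> complex) \<Rightarrow> bool" where
  "harmonic F \<longleftrightarrow> smooth F \<and> (\<forall>x. laplacian F x = 0)"

lemma harmonic_partial: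
  assumes "harmonic F"
  shows "harmonic (partial_deriv i F)"
proof -
  have s: "smooth F" and l: "(\<lambda>x. \<Sum>k\<in>UNIV. partial_deriv k (partial_deriv k F) x) = (\<lambda>x. 0)"
    using assms by (auto simp: harmonic_def laplacian_def)
  have swap: "partial_deriv k (partial_deriv k (partial_deriv i F))
      = partial_deriv i (partial_deriv k (partial_deriv k F))" for k
  proof -
    have "partial_deriv k (partial_deriv i F) = partial_deriv i (partial_deriv k F)"
      by (intro ext partial_commute s)
    then show ?thesis by (auto intro!: partial_commute smooth_partial s)
  qed
  have "laplacian (partial_deriv i F) x = 0" for x
    unfolding laplacian_def swap
    by (subst partial_sum[symmetric]) (simp_all add: smooth_partial s l)
  then show ?thesis by (simp add: harmonic_def smooth_partial s)
qed

lemma harmonic_add: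
  "harmonic F \<Longrightarrow> harmonic G \<Longrightarrow> harmonic (\<lambda>x. F x + G x)"
  by (simp add: harmonic_def smooth_add laplacian_def partial2_add sum.distrib)

lemma harmonic_cmult: "harmonic F \<Longrightarrow> harmonic (\<lambda>x. c * F x)"
  by (simp add: harmonic_def smooth_mult laplacian_def partial2_cmult flip: sum_distrib_left)

lemma harmonic_sum:
  "(\<And>k. k \<in> I \<Longrightarrow> harmonic (F k)) \<Longrightarrow> harmonic (\<lambda>x. \<Sum>k\<in>I. F k x)"
proof (induction I rule: infinite_finite_induct)
  case (insert k I)
  then show ?case by (simp add: harmonic_add)
qed (auto simp: harmonic_def laplacian_def)

lemma harmonic_dderiv: "harmonic F \<Longrightarrow> harmonic (dderiv w F)"
  unfolding dderiv_def[abs_def] by (intro harmonic_sum harmonic_cmult harmonic_partial)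

text \<open>The factor 2 comes from adding the estimates for the real and the imaginary
  part.\<close>

definition bernstein_const :: "'m itself \<Rightarrow> real" where
  "bernstein_const _ = 2 * sqrt (2 * real CARD('m) + 12)"

lemma partial_bound:
  fixes F :: "real^'m \<Rightarrow> complex"
  assumes F: "harmonic F" and R: "R > 0" and M: "\<And>y. y \<in> cball x R \<Longrightarrow> cmod (F y) \<le> M"
  shows "cmod (partial_deriv i F x) \<le> bernstein_const TYPE('m) / R * M"
proof -
  have s: "smooth F" using F by (simp add: harmonic_def)
  have "M \<ge> 0" using M[of x] R by (auto intro: order_trans[OF norm_ge_zero])
  have one: "\<bar>partial_deriv i u x\<bar> \<le> sqrt (2 * real CARD('m) + 12) / R * M"
    if u: "smooth u" "\<And>y. rlap u y = 0" "\<And>y. \<bar>u y\<bar> \<le> cmod (F y)" for u :: "real^'m \<Rightarrow> real"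
  proof -
    have "R\<^sup>2 * (partial_deriv i u x)\<^sup>2 \<le> (2 * real CARD('m) + 12) * M\<^sup>2"
      using M u(3) by (intro bernstein_gradient_estimate u(1,2) R) (meson order_trans)
    then have "(R * \<bar>partial_deriv i u x\<bar>)\<^sup>2 \<le> (sqrt (2 * real CARD('m) + 12) * M)\<^sup>2"
      by (simp add: power_mult_distrib)
    then have "R * \<bar>partial_deriv i u x\<bar> \<le> sqrt (2 * real CARD('m) + 12) * M"
      by (rule power2_le_imp_le) (simp add: \<open>M \<ge> 0\<close>)
    then show ?thesis using R by (simp add: field_simps)
  qed
  have "rlap (\<lambda>x. Re (F x)) y = Re (laplacian F y)" "rlap (\<lambda>x. Im (F x)) y = Im (laplacian F y)" for y
    by (simp_all add: rlap_def laplacian_def partial_Re partial_Im smooth_partial s)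
  then have "\<bar>partial_deriv i (\<lambda>x. Re (F x)) x\<bar> \<le> sqrt (2 * real CARD('m) + 12) / R * M"
    "\<bar>partial_deriv i (\<lambda>x. Im (F x)) x\<bar> \<le> sqrt (2 * real CARD('m) + 12) / R * M"
    using F by (intro one smooth_Re smooth_Im abs_Re_le_cmod abs_Im_le_cmod s; simp add: harmonic_def)+
  then have "cmod (partial_deriv i F x) \<le> 2 * (sqrt (2 * real CARD('m) + 12) / R * M)"
    using cmod_le[of "partial_deriv i F x"] unfolding partial_Re[OF s] partial_Im[OF s] by linarith
  then show ?thesis by (simp add: bernstein_const_def)
qed

lemma dderiv_bound:
  fixes F :: "real^'m \<Rightarrow> complex"
  assumes "harmonic F" "R > 0" "\<And>y. y \<in> cball x R \<Longrightarrow> cmod (F y) \<le> M"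
    "(\<Sum>i\<in>UNIV. cmod (w $ i)) \<le> \<kappa>"
  shows "cmod (dderiv w F x) \<le> \<kappa> * bernstein_const TYPE('m) / R * M"
proof -
  have "M \<ge> 0" using assms(3)[of x] assms(2) by (auto intro: order_trans[OF norm_ge_zero])
  have "cmod (dderiv w F x) \<le> (\<Sum>i\<in>UNIV. cmod (w $ i * partial_deriv i F x))"
    unfolding dderiv_def by (rule norm_sum)
  also have "\<dots> \<le> (\<Sum>i\<in>UNIV. cmod (w $ i) * (bernstein_const TYPE('m) / R * M))"
    unfolding norm_mult by (intro sum_mono mult_left_mono partial_bound assms(1-3)) auto
  also have "\<dots> = (\<Sum>i\<in>UNIV. cmod (w $ i)) * (bernstein_const TYPE('m) / R * M)"
    by (rule sum_distrib_right[symmetric])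
  also have "\<dots> \<le> \<kappa> * (bernstein_const TYPE('m) / R * M)"
    using assms(2,4) \<open>M \<ge> 0\<close> by (intro mult_right_mono) (auto simp: bernstein_const_def)
  finally show ?thesis by simp
qed

text \<open>Each derivative uses up a shell of width \<open>r\<close>. The choice
  \<open>r = R / n\<close> keeps the ball fixed and gives growth n^n / R^n, which the factorial in
  the Taylor remainder beats once \<open>R\<close> is large.\<close>

lemma dderiv_pow_bound:
  fixes F :: "real^'m \<Rightarrow> complex"
  assumes "r > 0" "(\<Sum>i\<in>UNIV. cmod (w $ i)) \<le> \<kappa>"
  shows "harmonic F \<Longrightarrow> (\<And>y. y \<in> cball x (real n * r) \<Longrightarrow> cmod (F y) \<le> M) \<Longrightarrow>
    cmod ((dderiv w ^^ n) F x) \<le> (\<kappa> * bernstein_const TYPE('m) / r) ^ n * M"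
proof (induction n arbitrary: F M)
  case 0
  then show ?case by simp
next
  case (Suc n)
  have "cmod ((dderiv w ^^ n) (dderiv w F) x)
      \<le> (\<kappa> * bernstein_const TYPE('m) / r) ^ n * (\<kappa> * bernstein_const TYPE('m) / r * M)"
  proof (rule Suc.IH)
    show "harmonic (dderiv w F)" using Suc.prems by (intro harmonic_dderiv)
    fix y assume y: "y \<in> cball x (real n * r)"
    show "cmod (dderiv w F y) \<le> \<kappa> * bernstein_const TYPE('m) / r * M"
    proof (rule dderiv_bound[OF Suc.prems(1) assms(1) _ assms(2)])
      fix z assume "z \<in> cball y r"
      then show "cmod (F z) \<le> M"
        using y dist_triangle[of x z y] by (intro Suc.prems) (simp add: algebra_simps)
    qed
  qed
  then show ?case by (simp add: funpow_swap1 mult_ac)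
qed

subsection \<open>Taylor expansions in complex directions\<close>

lemma dderiv_diff_scale_dir: "dderiv (w - of_real t *s v) F x = dderiv w F x - of_real t * dderiv v F x"
  by (simp add: dderiv_diff_dir dderiv_scale_dir)

text \<open>The base point moves by \<open>h\<close> and the direction by \<open>- h\<close>, so the
  target \<open>y + w\<close> stays fixed. The second term comes from differentiating the direction;
  its coefficient is zero for \<open>n = 0\<close>, where \<open>n - 1\<close> is truncated.\<close>

lemma dderiv_pow_moving:
  fixes F :: "real^'m \<Rightarrow> complex"
  defines "W \<equiv> \<lambda>w h t. w - complex_of_real t *s cvec h"
  shows "smooth F \<Longrightarrow> ((\<lambda>t. (dderiv (W w h t) ^^ n) F (y + t *\<^sub>R h)) has_vector_derivative
     (dderiv (W w h t) ^^ n) (dderiv (cvec h) F) (y + t *\<^sub>R h)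
     - of_nat n * (dderiv (W w h t) ^^ (n - 1)) (dderiv (cvec h) F) (y + t *\<^sub>R h)) (at t)"
proof (induction n arbitrary: F)
  case 0
  then show ?case by (simp add: dderiv_line)
next
  case (Suc n)
  let ?B = "dderiv (cvec h)" and ?D = "\<lambda>t. dderiv (W w h t)" and ?z = "\<lambda>t. y + t *\<^sub>R h"
  note s = Suc.prems
  have WF: "?D t G = (\<lambda>x. dderiv w G x - of_real t * ?B G x)" for t G
    unfolding W_def by (rule ext, rule dderiv_diff_scale_dir)
  \<comment> \<open>Peels off the innermost derivative and expands its \<open>t\<close>-dependent
    direction; the induction hypothesis then applies to \<open>dderiv w G\<close> and
    \<open>?B G\<close>, which do not depend on \<open>t\<close>.\<close>
  have pow: "(?D t ^^ Suc n) G = (\<lambda>x. (?D t ^^ n) (dderiv w G) x - of_real t * (?D t ^^ n) (?B G) x)"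
    if "smooth G" for t G
    unfolding funpow_Suc_right o_apply WF[of t G]
    by (intro dderiv_pow_linear smooth_dderiv that)
  let ?X = "\<lambda>G. (?D t ^^ n) (?B G) (?z t) - of_nat n * (?D t ^^ (n - 1)) (?B G) (?z t)"
  have "((\<lambda>t. (?D t ^^ Suc n) F (?z t)) has_vector_derivative
     ?X (dderiv w F) - (of_real t * ?X (?B F) + 1 * (?D t ^^ n) (?B F) (?z t))) (at t)"
    unfolding pow[OF s]
    by (intro has_vector_derivative_diff has_vector_derivative_mult Suc.IH smooth_dderiv s)
       (auto intro!: derivative_eq_intros simp: has_vector_derivative_def scaleR_conv_of_real)
  moreover have "?X (dderiv w F) - (of_real t * ?X (?B F) + 1 * (?D t ^^ n) (?B F) (?z t))
      = (?D t ^^ Suc n) (?B F) (?z t) - of_nat (Suc n) * (?D t ^^ n) (?B F) (?z t)"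
  proof -
    have c: "?B (dderiv w F) = dderiv w (?B F)" by (rule dderiv_commute[OF s])
    have 1: "(?D t ^^ n) (dderiv w (?B F)) (?z t) = (?D t ^^ Suc n) (?B F) (?z t)
        + of_real t * (?D t ^^ n) (?B (?B F)) (?z t)"
      unfolding pow[OF smooth_dderiv[OF s]] by simp
    have 2: "of_nat n * (?D t ^^ (n - 1)) (dderiv w (?B F)) (?z t) = of_nat n * ((?D t ^^ n) (?B F) (?z t)
        + of_real t * (?D t ^^ (n - 1)) (?B (?B F)) (?z t))"
    proof (cases n)
      case (Suc k)
      have "(?D t ^^ Suc k) G = (\<lambda>x. (?D t ^^ k) (dderiv w G) x - of_real t * (?D t ^^ k) (?B G) x)"
        if "smooth G" for G
        unfolding funpow_Suc_right o_apply WF[of t G]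
        by (intro dderiv_pow_linear smooth_dderiv that)
      from this[OF smooth_dderiv[OF s]] show ?thesis by (simp add: Suc del: funpow.simps)
    qed simp
    show ?thesis unfolding c 1 right_diff_distrib 2 by (simp add: algebra_simps del: funpow.simps)
  qed
  ultimately show ?case by (simp del: funpow.simps of_nat_Suc)
qed

text \<open>With a fixed target, differentiating the Taylor polynomial in its base point telescopes
  and only the top order survives.\<close>

lemma taylor_sum_moving:
  fixes F :: "real^'m \<Rightarrow> complex"
  defines "W \<equiv> \<lambda>w h t. w - complex_of_real t *s cvec h"
  assumes s: "smooth F"
  shows "((\<lambda>t. \<Sum>n\<le>N. (dderiv (W w h t) ^^ n) F (y + t *\<^sub>R h) / fact n) has_vector_derivative
     (dderiv (W w h t) ^^ N) (dderiv (cvec h) F) (y + t *\<^sub>R h) / fact N) (at t)"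
proof (induction N)
  case 0
  then show ?case using dderiv_line[OF s] by simp
next
  case (Suc N)
  let ?P = "\<lambda>n. (dderiv (W w h t) ^^ n) (dderiv (cvec h) F) (y + t *\<^sub>R h)"
  have d: "((\<lambda>t. (dderiv (W w h t) ^^ Suc N) F (y + t *\<^sub>R h) / fact (Suc N)) has_vector_derivative
      (?P (Suc N) - of_nat (Suc N) * ?P N) / fact (Suc N)) (at t)"
    using has_vector_derivative_divide[OF dderiv_pow_moving[OF s, where n = "Suc N" and w = w and h = h and y = y and t = t],
        of "fact (Suc N)"]
    by (simp add: W_def del: funpow.simps fact_Suc of_nat_Suc)
  have "?P N / fact N + (?P (Suc N) - of_nat (Suc N) * ?P N) / fact (Suc N) = ?P (Suc N) / fact (Suc N)"
    by (simp add: diff_divide_distrib del: funpow.simps of_nat_Suc)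
  with has_vector_derivative_add[OF Suc.IH d] show ?case
    by (simp del: funpow.simps fact_Suc of_nat_Suc)
qed

text \<open>With \<open>x = n\<close> this is n^n <= e^n n!, used in place of Stirling's
  formula.\<close>

lemma power_le_exp_fact:
  fixes x :: real
  assumes "x \<ge> 0"
  shows "x ^ n \<le> exp x * fact n"
proof -
  have "(\<Sum>k\<in>{n}. x ^ k /\<^sub>R fact k) \<le> (\<Sum>k. x ^ k /\<^sub>R fact k)"
    using assms exp_converges[of x] by (intro sum_le_suminf) (auto simp: sums_iff)
  also have "\<dots> = exp x" using exp_converges[of x] by (simp add: sums_iff)
  finally show ?thesis by (simp add: divide_simps)
qed

text \<open>Both Taylor series represent the value of the entire extension of \<open>F\<close> to \<open>\<complex>\<^sup>m\<close> at the
  common point \<open>y + w\<^sub>2 = (y + h) + w\<^sub>1\<close>.  The remainder is controlled on balls of arbitrarily large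
  radius, which is where the global definition of \<open>F\<close> enters.\<close>

lemma taylor_two_point:
  fixes F :: "real^'m \<Rightarrow> complex"
  assumes F: "harmonic F" and w: "w2 = w1 + cvec h"
    and zero2: "\<And>n. n \<ge> 1 \<Longrightarrow> (dderiv w2 ^^ n) F y = 0"
    and zero1: "\<And>n. n \<ge> 1 \<Longrightarrow> (dderiv w1 ^^ n) F (y + h) = 0"
  shows "F (y + h) = F y"
proof -
  define W where "W = (\<lambda>t. w2 - complex_of_real t *s cvec h)"
  define \<kappa> where "\<kappa> = (\<Sum>i\<in>UNIV. cmod (w2 $ i)) + (\<Sum>i\<in>UNIV. \<bar>h $ i\<bar>)"
  define K where "K = bernstein_const TYPE('m)"
  \<comment> \<open>Makes \<open>exp 1 * (\<kappa> * K) / R\<close> at most 1/2, the ratio of the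
    final geometric bound; the summand 1 keeps \<open>R\<close> positive.\<close>
  define R where "R = 2 * exp 1 * (\<kappa> * K) + 1"
  let ?B = "dderiv (cvec h) F"
  have s: "smooth F" using F by (simp add: harmonic_def)
  have "\<kappa> \<ge> 0" "K \<ge> 0" by (auto simp: \<kappa>_def K_def bernstein_const_def intro!: add_nonneg_nonneg sum_nonneg)
  then have "\<kappa> * K \<ge> 0" by simp
  then have R: "R > 0" by (simp add: R_def add_nonneg_pos)
  have \<kappa>: "(\<Sum>i\<in>UNIV. cmod (W t $ i)) \<le> \<kappa>" if "0 \<le> t" "t \<le> 1" for t
  proof -
    have "cmod (W t $ i) \<le> cmod (w2 $ i) + \<bar>h $ i\<bar>" for i
    proof -
      have "cmod (W t $ i) \<le> cmod (w2 $ i) + cmod (of_real t * of_real (h $ i))"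
        by (simp add: W_def cvec_def norm_triangle_ineq4)
      also have "cmod (of_real t * of_real (h $ i)) \<le> \<bar>h $ i\<bar>"
        using that by (simp add: norm_mult mult_left_le_one_le)
      finally show ?thesis by simp
    qed
    then show ?thesis by (simp add: \<kappa>_def sum_mono flip: sum.distrib)
  qed
  \<comment> \<open>One ball contains all balls of radius \<open>R\<close> about points of the
    segment from \<open>y\<close> to \<open>y + h\<close>, so \<open>M\<close> does not depend on
    the order \<open>N\<close>.\<close>
  have "compact (?B ` cball y (norm h + R))"
    by (intro compact_continuous_image smooth_continuous smooth_dderiv s compact_cball)
  then obtain M where M: "\<And>z. z \<in> cball y (norm h + R) \<Longrightarrow> cmod (?B z) \<le> M"
    by (metis bounded_iff compact_imp_bounded imageI)
  have "M \<ge> 0" using M[of y] R by (auto intro: order_trans[OF norm_ge_zero])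
  have W0: "W 0 = w2" and W1: "W 1 = w1" by (simp_all add: W_def w)
  have bound: "cmod (F (y + h) - F y) \<le> M * (1 / 2) ^ N" if N: "N \<ge> 1" for N
  proof -
    define \<phi> where "\<phi> = (\<lambda>t. \<Sum>n\<le>N. (dderiv (W t) ^^ n) F (y + t *\<^sub>R h) / fact n)"
    have \<phi>': "(\<phi> has_vector_derivative (dderiv (W t) ^^ N) ?B (y + t *\<^sub>R h) / fact N) (at t)" for t
      unfolding \<phi>_def W_def by (rule taylor_sum_moving[OF s])
    have first: "(\<Sum>n\<le>N. g n / fact n) = g 0" if "\<And>n. n \<ge> 1 \<Longrightarrow> g n = 0" for g :: "nat \<Rightarrow> complex"
      using that by (subst sum.remove[of _ 0]) (auto intro!: sum.neutral)
    have ends: "\<phi> 1 = F (y + h)" "\<phi> 0 = F y"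
      unfolding \<phi>_def W0 W1 by (subst first; simp add: zero1 zero2)+
    have "\<exists>t\<in>{0<..<1}. norm (\<phi> 1 - \<phi> 0) \<le> norm ((\<lambda>s. s *\<^sub>R ((dderiv (W t) ^^ N) ?B (y + t *\<^sub>R h) / fact N)) (1 - 0))"
      using \<phi>' by (intro mvt_general)
        (auto simp: has_vector_derivative_def intro!: continuous_at_imp_continuous_on has_derivative_continuous)
    then obtain t where t: "0 < t" "t < 1"
      "norm (\<phi> 1 - \<phi> 0) \<le> cmod ((dderiv (W t) ^^ N) ?B (y + t *\<^sub>R h)) / fact N"
      by (auto simp: norm_divide)
    have "cmod ((dderiv (W t) ^^ N) ?B (y + t *\<^sub>R h)) \<le> (\<kappa> * K / (R / N)) ^ N * M"
      unfolding K_def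
    proof (rule dderiv_pow_bound)
      show "R / N > 0" using R N by simp
      show "(\<Sum>i\<in>UNIV. cmod (W t $ i)) \<le> \<kappa>" using \<kappa> t by simp
      show "harmonic ?B" by (intro harmonic_dderiv F)
      fix z assume "z \<in> cball (y + t *\<^sub>R h) (real N * (R / N))"
      then have "dist (y + t *\<^sub>R h) z \<le> R" using N by simp
      moreover have "dist y (y + t *\<^sub>R h) \<le> norm h"
        using t by (simp add: dist_norm mult_left_le_one_le)
      ultimately show "cmod (?B z) \<le> M"
        using dist_triangle[of y z "y + t *\<^sub>R h"] by (intro M) simp
    qed
    also have "(\<kappa> * K / (R / N)) ^ N * M = (\<kappa> * K / R) ^ N * real N ^ N * M"
      by (simp add: power_mult_distrib power_divide)
    also have "\<dots> \<le> (\<kappa> * K / R) ^ N * (exp (real N) * fact N) * M"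
      using \<open>\<kappa> * K \<ge> 0\<close> R \<open>M \<ge> 0\<close>
      by (intro mult_right_mono mult_left_mono power_le_exp_fact) auto
    also have "\<dots> = (exp 1 * (\<kappa> * K) / R) ^ N * M * fact N"
      by (simp add: power_mult_distrib power_divide exp_of_nat_mult[of N 1, simplified])
    also have "\<dots> \<le> (1 / 2) ^ N * M * fact N"
      using \<open>\<kappa> * K \<ge> 0\<close> R \<open>M \<ge> 0\<close>
      by (intro mult_right_mono power_mono) (auto simp: R_def divide_simps)
    finally have "cmod ((dderiv (W t) ^^ N) ?B (y + t *\<^sub>R h)) / fact N \<le> M * (1 / 2) ^ N"
      by (subst pos_divide_le_eq) (simp_all add: mult.commute)
    then show ?thesis using t(3) unfolding ends by linarith
  qed
  have "(\<lambda>N. M * (1 / 2) ^ N) \<longlonglongrightarrow> M * 0"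
    by (intro tendsto_mult tendsto_const LIMSEQ_power_zero) simp
  then have "cmod (F (y + h) - F y) \<le> M * 0"
    using bound by (intro LIMSEQ_le_const) auto
  then show ?thesis by simp
qed

text \<open>The two-point comparison with direction \<open>cvec (z - x)\<close> at \<open>x\<close>
  and direction \<open>0\<close> at \<open>z\<close>: the derivatives at \<open>x\<close> vanish
  because \<open>F\<close> is zero nearby, those in direction \<open>0\<close> vanish
  trivially.\<close>

lemma harmonic_unique_continuation:
  fixes F :: "real^'m \<Rightarrow> complex"
  assumes F: "harmonic F" and U: "open U" "x \<in> U" and zero: "\<And>y. y \<in> U \<Longrightarrow> F y = 0"
  shows "F z = 0"
proof -
  have "\<forall>y\<in>U. (dderiv w ^^ n) F y = 0" for w n
  proof (induction n)
    case (Suc n)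
    then show ?case using dderiv_cong_ev[OF U(1), of _ "(dderiv w ^^ n) F" "\<lambda>_. 0" w] by simp
  qed (simp add: zero)
  then have "(dderiv w ^^ n) F x = 0" for w n using U by blast
  moreover have "(dderiv 0 ^^ n) F = (\<lambda>_. 0)" if "n \<ge> 1" for n
    using that by (cases n) auto
  ultimately have "F (x + (z - x)) = F x"
    using taylor_two_point[OF F, of "cvec (z - x)" 0 "z - x" x] by simp
  then show ?thesis using zero U by simp
qed

subsection \<open>Null frames and the Hessian of an eigenfunction\<close>

text \<open>Says a d^T + d a^T - b c^T - c b^T = 2 I. The pairings of a vector p with the frame form
  a 2 by 2 matrix whose determinant is the bilinear square of p. Relations among the frame vectors
  themselves would not survive a coordinate projection; this one does, so all m up to 4 are treated
  alike.\<close>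

definition null_frame :: "complex^'m \<Rightarrow> complex^'m \<Rightarrow> complex^'m \<Rightarrow> complex^'m \<Rightarrow> bool" where
  "null_frame a b c d \<longleftrightarrow> (\<forall>i j. a $ i * d $ j + d $ i * a $ j - b $ i * c $ j - c $ i * b $ j
     = (if i = j then 2 else 0))"

text \<open>For \<open>m < 4\<close> the vectors are the images of a null basis of \<open>\<complex>\<^sup>4\<close> under a coordinate projection.\<close>

lemma null_frame_exists:
  assumes "CARD('m::finite) \<le> 4"
  shows "\<exists>a b c d :: complex^'m. null_frame a b c d"
proof -
  obtain g :: "'m \<Rightarrow> nat" where g: "inj g" "range g \<subseteq> {..<4}"
    using assms card_le_inj[of "UNIV :: 'm set" "{..<4::nat}"] by auto
  define u where "u = (\<lambda>z0 z1 z2 z3 :: complex. (\<chi> i. if g i = 0 then z0 else if g i = 1 then z1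
      else if g i = 2 then z2 else z3) :: complex^'m)"
  \<comment> \<open>The vectors e0 + i e1, e2 + i e3, -e2 + i e3 and e0 - i e1, restricted to the
    coordinates in the range of \<open>g\<close>.\<close>
  have "null_frame (u 1 \<i> 0 0) (u 0 0 1 \<i>) (u 0 0 (-1) \<i>) (u 1 (-\<i>) 0 0)"
    unfolding null_frame_def
  proof (intro allI)
    fix i j
    have eq: "i = j \<longleftrightarrow> g i = g j" using g(1) by (auto dest: injD)
    have "g i \<in> {..<4}" "g j \<in> {..<4}" using g(2) by auto
    then have "g i \<in> {0, 1, 2, 3}" "g j \<in> {0, 1, 2, 3}" by (auto simp: numeral_eq_Suc less_Suc_eq)
    then show "u 1 \<i> 0 0 $ i * u 1 (-\<i>) 0 0 $ j + u 1 (-\<i>) 0 0 $ i * u 1 \<i> 0 0 $ j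
        - u 0 0 1 \<i> $ i * u 0 0 (-1) \<i> $ j - u 0 0 (-1) \<i> $ i * u 0 0 1 \<i> $ j = (if i = j then 2 else 0)"
      unfolding eq by (auto simp: u_def)
  qed
  then show ?thesis by blast
qed

definition cgrad :: "(real^'m \<Rightarrow> complex) \<Rightarrow> real^'m \<Rightarrow> complex^'m" where
  "cgrad F x = (\<chi> i. partial_deriv i F x)"

lemma dderiv_cgrad: "dderiv w F x = bilinear_pairing w (cgrad F x)"
  by (simp add: dderiv_def bilinear_pairing_def cgrad_def)

lemma bilinear_pairing_commute: "bilinear_pairing v w = bilinear_pairing w v"
  by (simp add: bilinear_pairing_def mult.commute)

lemma complex_gradient_eq: "smooth F \<Longrightarrow> complex_gradient F x = cgrad F x"
  by (simp add: complex_gradient_def cgrad_def gradient_def partial_Re partial_Im complex_eq[symmetric])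

lemma null_frame_sum:
  assumes "null_frame a b c d"
  shows "(\<Sum>i\<in>UNIV. \<Sum>j\<in>UNIV. (a $ i * d $ j + d $ i * a $ j - b $ i * c $ j - c $ i * b $ j) * M i j)
    = 2 * (\<Sum>i\<in>UNIV. M i i)"
proof -
  have "(\<Sum>i\<in>UNIV. \<Sum>j\<in>UNIV. (a $ i * d $ j + d $ i * a $ j - b $ i * c $ j - c $ i * b $ j) * M i j)
      = (\<Sum>i\<in>UNIV. \<Sum>j\<in>UNIV. if i = j then 2 * M i j else 0)"
    using assms by (intro sum.cong refl) (simp add: null_frame_def)
  then show ?thesis by (simp add: sum_distrib_left)
qed

lemma null_frame_pairing:
  assumes "null_frame a b c d"
  shows "2 * bilinear_pairing p q
    = bilinear_pairing a p * bilinear_pairing d q + bilinear_pairing d p * bilinear_pairing a q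
    - bilinear_pairing b p * bilinear_pairing c q - bilinear_pairing c p * bilinear_pairing b q"
  using null_frame_sum[OF assms, of "\<lambda>i j. p $ i * q $ j"]
  unfolding bilinear_pairing_def sum_product sum.distrib[symmetric] sum_subtractf[symmetric]
  by (simp add: algebra_simps)

lemma null_frame_span:
  assumes "null_frame a b c d"
  obtains \<alpha> \<beta> \<gamma> \<delta> where "v = \<alpha> *s a + \<beta> *s b + \<gamma> *s c + \<delta> *s d"
proof
  let ?p = "\<lambda>w. bilinear_pairing w v / 2"
  show "v = ?p d *s a + (- ?p c) *s b + (- ?p b) *s c + ?p a *s d"
  proof (rule vec_eq_iff[THEN iffD2], rule allI)
    fix i
    have e: "bilinear_pairing w (axis i 1) = w $ i" for w :: "complex^'a"
      by (simp add: bilinear_pairing_def axis_def if_distrib cong: if_cong)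
    have eq: "2 * v $ i = a $ i * bilinear_pairing d v + d $ i * bilinear_pairing a v
        - b $ i * bilinear_pairing c v - c $ i * bilinear_pairing b v"
      using null_frame_pairing[OF assms, of "axis i 1" v]
      by (simp add: e bilinear_pairing_commute[of "axis i 1" v])
    have "v $ i = (a $ i * bilinear_pairing d v + d $ i * bilinear_pairing a v
        - b $ i * bilinear_pairing c v - c $ i * bilinear_pairing b v) / 2"
      unfolding eq[symmetric] by simp
    then show "v $ i = (?p d *s a + (- ?p c) *s b + (- ?p b) *s c + ?p a *s d) $ i"
      by (simp add: diff_divide_distrib add_divide_distrib mult.commute)
  qed
qed

lemma null_frame_laplacian:
  assumes fr: "null_frame a b c d" and s: "smooth F"
  shows "laplacian F x = dderiv a (dderiv d F) x - dderiv b (dderiv c F) x"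
proof -
  have two: "dderiv v (dderiv w F) x = (\<Sum>i\<in>UNIV. \<Sum>j\<in>UNIV. v $ i * w $ j * partial_deriv i (partial_deriv j F) x)"
    for v w
    by (simp add: dderiv_def[of v] partial_dderiv s)
       (simp add: dderiv_def partial_commute[OF s] sum_distrib_left mult_ac)
  have "2 * laplacian F x = dderiv a (dderiv d F) x + dderiv d (dderiv a F) x
      - dderiv b (dderiv c F) x - dderiv c (dderiv b F) x"
    using null_frame_sum[OF fr, of "\<lambda>i j. partial_deriv i (partial_deriv j F) x"]
    unfolding two laplacian_def sum.distrib[symmetric] sum_subtractf[symmetric]
    by (simp add: algebra_simps)
  then have "2 * laplacian F x = 2 * (dderiv a (dderiv d F) x - dderiv b (dderiv c F) x)"
    by (simp add: dderiv_commute[OF s, of d a] dderiv_commute[OF s, of c b])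
  then show ?thesis by (subst (asm) mult_left_cancel) simp_all
qed

section \<open>The eikonal equation, its derivatives and the shear\<close>

definition eigenfunction :: "(real^'m \<Rightarrow> complex) \<Rightarrow> bool" where
  "eigenfunction F \<longleftrightarrow> harmonic F \<and> (\<forall>x. bilinear_pairing (cgrad F x) (cgrad F x) = 0)"

lemma null_frame_eikonal:
  assumes fr: "null_frame a b c d" and F: "eigenfunction F"
  shows "dderiv a F x * dderiv d F x = dderiv b F x * dderiv c F x"
  using null_frame_pairing[OF fr, of "cgrad F x" "cgrad F x"] F
  by (simp add: eigenfunction_def dderiv_cgrad mult.commute)

lemma null_frame_eikonal_deriv:
  assumes fr: "null_frame a b c d" and F: "eigenfunction F"
  shows "dderiv a F x * dderiv v (dderiv d F) x + dderiv v (dderiv a F) x * dderiv d F x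
    = dderiv b F x * dderiv v (dderiv c F) x + dderiv v (dderiv b F) x * dderiv c F x"
proof -
  have s: "smooth F" using F by (simp add: eigenfunction_def harmonic_def)
  have "(\<lambda>x. dderiv a F x * dderiv d F x) = (\<lambda>x. dderiv b F x * dderiv c F x)"
    using null_frame_eikonal[OF fr F] by blast
  then have "dderiv v (\<lambda>x. dderiv a F x * dderiv d F x) x = dderiv v (\<lambda>x. dderiv b F x * dderiv c F x) x"
    by simp
  then show ?thesis by (simp add: dderiv_mult smooth_dderiv s)
qed

lemma dderiv2_mult:
  assumes "smooth F" "smooth G"
  shows "dderiv v (dderiv w (\<lambda>x. F x * G x)) x = F x * dderiv v (dderiv w G) x
    + dderiv v F x * dderiv w G x + dderiv w F x * dderiv v G x + dderiv v (dderiv w F) x * G x"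
proof -
  have "dderiv w (\<lambda>x. F x * G x) = (\<lambda>x. F x * dderiv w G x + dderiv w F x * G x)"
    using assms by (intro ext dderiv_mult)
  then show ?thesis by (simp add: dderiv_add dderiv_mult smooth_mult smooth_dderiv assms)
qed

text \<open>Bochner's formula: the Laplacian of the squared gradient gives that the square of the
  Hessian has trace zero, here in frame coordinates. The terms of third order cancel because
  derivatives of \<open>F\<close> are harmonic (\<open>box\<close>).\<close>

lemma null_frame_eikonal_laplacian:
  assumes fr: "null_frame a b c d" and F: "eigenfunction F"
  shows "dderiv a (dderiv a F) x * dderiv d (dderiv d F) x + dderiv b (dderiv b F) x * dderiv c (dderiv c F) x
     + (dderiv a (dderiv d F) x)\<^sup>2 + (dderiv b (dderiv c F) x)\<^sup>2
   = 2 * dderiv a (dderiv b F) x * dderiv c (dderiv d F) x + 2 * dderiv a (dderiv c F) x * dderiv b (dderiv d F) x"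
proof -
  have s: "smooth F" and h: "harmonic F" using F by (auto simp: eigenfunction_def harmonic_def)
  have box: "dderiv b (dderiv c (dderiv v F)) x = dderiv a (dderiv d (dderiv v F)) x" for v
    using harmonic_dderiv[OF h, of v] null_frame_laplacian[OF fr, of "dderiv v F" x]
    by (simp add: harmonic_def)
  have eik: "(\<lambda>x. dderiv a F x * dderiv d F x) = (\<lambda>x. dderiv b F x * dderiv c F x)"
    using null_frame_eikonal[OF fr F] by blast
  then have "dderiv v (dderiv w (\<lambda>x. dderiv a F x * dderiv d F x)) x
      = dderiv v (dderiv w (\<lambda>x. dderiv b F x * dderiv c F x)) x" for v w
    by simp
  note eqs = this[of a d] this[of b c]
  have comm: "dderiv v (dderiv w F) x = dderiv w (dderiv v F) x" for v w
    by (simp only: dderiv_commute[OF s, of v w])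
  show ?thesis
    using eqs[unfolded dderiv2_mult[OF smooth_dderiv[OF s] smooth_dderiv[OF s]]]
      box[of a] box[of b] box[of c] box[of d]
      comm[of a b] comm[of a c] comm[of a d] comm[of b c] comm[of b d] comm[of c d]
    by algebra
qed

text \<open>The Hessian of \<open>F\<close> evaluated twice on the vector
  \<open>dderiv a F x *s c - dderiv c F x *s a\<close>, which annihilates \<open>F\<close>. With the
  slope m = F_c / F_a it equals F_a^3 times the derivative of m in direction c - m a, so it vanishes
  exactly when the slope is constant to first order along its own null direction.\<close>

definition shear :: "complex^'m \<Rightarrow> complex^'m \<Rightarrow> (real^'m \<Rightarrow> complex) \<Rightarrow> real^'m \<Rightarrow> complex" where
  "shear a c F x = (dderiv a F x)\<^sup>2 * dderiv c (dderiv c F) x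
     - 2 * dderiv a F x * dderiv c F x * dderiv a (dderiv c F) x
     + (dderiv c F x)\<^sup>2 * dderiv a (dderiv a F) x"

text \<open>If \<open>\<mu> = \<nu> = 0\<close>, the differentiated eikonal equation kills all
  Hessian entries with \<open>d\<close>, harmonicity kills the entry \<open>b c\<close>, and the
  Bochner identity reduces to \<open>?H b b * ?H c c = 0\<close>. The general case is this one in
  the frame adapted to the gradient, with \<open>c - \<mu> *s a\<close> and
  \<open>b - \<nu> *s a\<close> in place of \<open>c\<close> and \<open>b\<close>.\<close>

lemma shear_product:
  assumes fr: "null_frame a b c d" and F: "eigenfunction F" and ne: "dderiv a F x \<noteq> 0"
  shows "shear a c F x * shear a b F x = 0"
proof -
  have s: "smooth F" and h: "harmonic F" using F by (auto simp: eigenfunction_def harmonic_def)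
  define p \<mu> \<nu> where "p = dderiv a F x" and "\<mu> = dderiv c F x / p" and "\<nu> = dderiv b F x / p"
  let ?H = "\<lambda>v w. dderiv v (dderiv w F) x"
  have p: "p \<noteq> 0" using ne by (simp add: p_def)
  have c: "dderiv c F x = \<mu> * p" and b: "dderiv b F x = \<nu> * p" using p by (auto simp: \<mu>_def \<nu>_def)
  have d: "dderiv d F x = \<mu> * \<nu> * p"
    using null_frame_eikonal[OF fr F, of x] p unfolding c b p_def[symmetric] by (simp add: mult_ac)
  have X: "?H v d = \<nu> * ?H v c + \<mu> * ?H v b - \<mu> * \<nu> * ?H v a" for v
  proof -
    have "p * ?H v d = p * (\<nu> * ?H v c + \<mu> * ?H v b - \<mu> * \<nu> * ?H v a)"
      using null_frame_eikonal_deriv[OF fr F, of x v] unfolding c b d p_def[symmetric] by algebra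
    then show ?thesis using p by simp
  qed
  have H: "?H b c = ?H a d"
    using null_frame_laplacian[OF fr s, of x] h by (simp add: harmonic_def)
  have "(?H c c - 2 * \<mu> * ?H a c + \<mu>\<^sup>2 * ?H a a) * (?H b b - 2 * \<nu> * ?H a b + \<nu>\<^sup>2 * ?H a a) = 0"
    using null_frame_eikonal_laplacian[OF fr F, of x] X[of a] X[of b] X[of c] X[of d] H
    unfolding dderiv_commute[OF s, of d a] dderiv_commute[OF s, of d b] dderiv_commute[OF s, of d c]
      dderiv_commute[OF s, of c a] dderiv_commute[OF s, of c b] dderiv_commute[OF s, of b a]
    by algebra
  moreover have "shear a c F x = p\<^sup>2 * (?H c c - 2 * \<mu> * ?H a c + \<mu>\<^sup>2 * ?H a a)"
    "shear a b F x = p\<^sup>2 * (?H b b - 2 * \<nu> * ?H a b + \<nu>\<^sup>2 * ?H a a)"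
    unfolding shear_def c b p_def[symmetric] by algebra+
  ultimately show ?thesis by auto
qed

subsection \<open>Gradients of a single eigenfunction\<close>

text \<open>Multiplied through by \<open>F x\<close> to avoid the exponent
  \<open>k - 1\<close>.\<close>

lemma dderiv_power:
  assumes "smooth F"
  shows "F x * dderiv w (\<lambda>x. F x ^ k) x = of_nat k * dderiv w F x * F x ^ k"
proof (induction k)
  case (Suc k)
  have "dderiv w (\<lambda>x. F x ^ Suc k) x = F x * dderiv w (\<lambda>x. F x ^ k) x + dderiv w F x * F x ^ k"
    using dderiv_mult[OF assms smooth_power[OF assms, of k], of w x] by simp
  then show ?case by (simp add: Suc.IH algebra_simps)
qed simp

text \<open>Where the shear vanishes, \<open>F\<close> is formally constant along the null plane spanned by
  \<open>c - \<kappa> a\<close> and \<open>d - \<kappa> b\<close>: the functions \<open>G\<close> with \<open>F\<^sub>a\<^sup>k G = (F\<^sub>c - \<kappa> F\<^sub>a) g\<close> on \<open>B\<close> for some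
  \<open>k\<close> and smooth \<open>g\<close> are closed under differentiation in the directions of that plane.\<close>

lemma dderiv_pow_null_plane:
  assumes fr: "null_frame a b c d" and F: "eigenfunction F"
    and B: "open B" "\<And>y. y \<in> B \<Longrightarrow> dderiv a F y \<noteq> 0" "\<And>y. y \<in> B \<Longrightarrow> shear a c F y = 0"
    and x: "x \<in> B" "dderiv c F x = \<kappa> * dderiv a F x"
    and w: "w = \<sigma> *s (c - \<kappa> *s a) + \<tau> *s (d - \<kappa> *s b)" and n: "n \<ge> 1"
  shows "(dderiv w ^^ n) F x = 0"
proof -
  define f q z where "f = dderiv a F" and "q = (\<lambda>y. dderiv c F y - \<kappa> * f y)" and "z = \<sigma> *s a + \<tau> *s b"
  \<comment> \<open>With m = F_c / F_a, \<open>q\<close> is \<open>f\<close> times m - kappa, and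
    \<open>w\<close> is the corresponding vector of the plane of slope m plus m - kappa times
    \<open>z\<close>. A slope constant along its own plane satisfies D_w m = (m - kappa) D_z m;
    clearing denominators produces \<open>r\<close>.\<close>
  define r where "r = (\<lambda>y. f y * dderiv w f y - q y * dderiv z f y + f y * dderiv z q y)"
  let ?I = "\<lambda>G k g. smooth g \<and> (\<forall>y\<in>B. f y ^ k * G y = q y * g y)"
  have s: "smooth F" using F by (simp add: eigenfunction_def harmonic_def)
  have f: "smooth f" unfolding f_def by (intro smooth_dderiv s)
  have q: "smooth q" unfolding q_def by (intro smooth_diff smooth_mult smooth_const smooth_dderiv s f)
  have r: "smooth r" unfolding r_def
    by (intro smooth_add smooth_diff smooth_mult smooth_dderiv f q)
  have dw: "dderiv w G y = \<sigma> * (dderiv c G y - \<kappa> * dderiv a G y) + \<tau> * (dderiv d G y - \<kappa> * dderiv b G y)"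
    for G y
    unfolding w by (simp add: dderiv_add_dir dderiv_diff_dir dderiv_scale_dir right_diff_distrib)
  have dz: "dderiv z G y = \<sigma> * dderiv a G y + \<tau> * dderiv b G y" for G y
    unfolding z_def by (simp add: dderiv_add_dir dderiv_scale_dir)
  have dq: "dderiv v q y = dderiv v (dderiv c F) y - \<kappa> * dderiv v f y" for v y
    unfolding q_def by (simp add: dderiv_diff dderiv_cmult smooth_dderiv smooth_mult s f)
  have first: "f y * dderiv w F y = q y * dderiv z F y" for y
    using null_frame_eikonal[OF fr F, of y] unfolding dw dz q_def f_def by algebra
  \<comment> \<open>Here the vanishing shear enters: \<open>q\<close> itself stays divisible by
    \<open>q\<close> when differentiated along \<open>w\<close>.\<close>
  have second: "(f y)\<^sup>2 * dderiv w q y = q y * r y" if "y \<in> B" for y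
  proof -
    let ?H = "\<lambda>v w. dderiv v (dderiv w F) y"
    have comm: "?H v w = ?H w v" for v w
      by (simp only: dderiv_commute[OF s, of v w])
    have H: "?H b c = ?H a d"
      using null_frame_laplacian[OF fr s, of y] F by (simp add: eigenfunction_def harmonic_def)
    have p: "f y \<noteq> 0" using B(2)[OF that] by (simp add: f_def)
    have "f y * ((f y)\<^sup>2 * dderiv w q y - q y * r y) = 0"
      using B(3)[OF that] null_frame_eikonal[OF fr F, of y] H
        null_frame_eikonal_deriv[OF fr F, of y c] null_frame_eikonal_deriv[OF fr F, of y a]
        comm[of a b] comm[of a c] comm[of a d] comm[of b c] comm[of b d] comm[of c d]
      unfolding r_def dw dz dq unfolding shear_def q_def f_def by algebra
    then show ?thesis using p by simp
  qed
  have step: "\<exists>k g. ?I (dderiv w G) k g" if G: "smooth G" "?I G k g" for G k g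
  proof (intro exI conjI ballI)
    let ?g = "\<lambda>y. (f y)\<^sup>2 * dderiv w g y + r y * g y - of_nat k * f y * dderiv w f y * g y"
    have fk: "smooth (\<lambda>y. f y ^ k)" by (intro smooth_power f)
    show "smooth ?g"
      using G by (intro smooth_add smooth_diff smooth_mult smooth_power smooth_const smooth_dderiv f r) auto
    fix y assume y: "y \<in> B"
    have "dderiv w (\<lambda>y. f y ^ k * G y) y = dderiv w (\<lambda>y. q y * g y) y"
      using G by (intro dderiv_cong_ev[OF B(1) y]) auto
    then have "f y ^ k * dderiv w G y + dderiv w (\<lambda>y. f y ^ k) y * G y = q y * dderiv w g y + dderiv w q y * g y"
      using G by (simp add: dderiv_mult fk q)
    moreover have "f y ^ k * G y = q y * g y" using G y by blast
    \<comment> \<open>The product rule with all values abstracted to free variables, so that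
      \<open>algebra\<close> does not meet the symbolic exponent \<open>k\<close>.\<close>
    moreover have "P * p\<^sup>2 * DG = q0 * (p\<^sup>2 * Dg + r0 * g0 - K * p * Df * g0)"
      if "P * DG + DP * G0 = q0 * Dg + Dq * g0" "P * G0 = q0 * g0" "p * DP = K * Df * P" "p\<^sup>2 * Dq = q0 * r0"
      for P p DG q0 Dg r0 g0 K Df DP G0 Dq :: complex
      using that by algebra
    ultimately have "f y ^ k * (f y)\<^sup>2 * dderiv w G y = q y * ?g y"
      using dderiv_power[OF f, of y w k] second[OF y] by blast
    then show "f y ^ (k + 2) * dderiv w G y = q y * ?g y" by (simp only: power_add)
  qed
  have ideal: "\<exists>k g. ?I ((dderiv w ^^ Suc j) F) k g" for j
  proof (induction j)
    case 0
    have "?I ((dderiv w ^^ Suc 0) F) 1 (dderiv z F)"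
      using first by (simp add: smooth_dderiv s)
    then show ?case by blast
  next
    case (Suc j)
    then obtain k g where "?I ((dderiv w ^^ Suc j) F) k g" by blast
    then have "\<exists>k g. ?I (dderiv w ((dderiv w ^^ Suc j) F)) k g"
      by (intro step[OF smooth_dderiv_pow[OF s]])
    then show ?case by (simp only: funpow.simps(2)[of "Suc j"] o_apply)
  qed
  obtain j where j: "n = Suc j" using n by (cases n) auto
  obtain k g where "f x ^ k * (dderiv w ^^ n) F x = q x * g x"
    using ideal[of j] x(1) unfolding j by blast
  then show ?thesis using x B(2)[of x] by (simp add: q_def f_def)
qed

text \<open>Two null planes of the same family with different slopes are complementary in \<open>\<complex>\<^sup>4\<close>, hence the
  planes attached to \<open>x\<close> and \<open>y\<close> meet.\<close>

lemma eq_of_pairing_ne_zero: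
  assumes fr: "null_frame a b c d" and F: "eigenfunction F"
    and B: "open B" "\<And>y. y \<in> B \<Longrightarrow> dderiv a F y \<noteq> 0" "\<And>y. y \<in> B \<Longrightarrow> shear a c F y = 0"
    and xy: "x \<in> B" "y \<in> B" "bilinear_pairing (cgrad F x) (cgrad F y) \<noteq> 0"
  shows "F x = F y"
proof -
  define \<mu> \<mu>' where "\<mu> = dderiv c F x / dderiv a F x" and "\<mu>' = dderiv c F y / dderiv a F y"
  have c: "dderiv c F x = \<mu> * dderiv a F x" "dderiv c F y = \<mu>' * dderiv a F y"
    using B(2) xy by (auto simp: \<mu>_def \<mu>'_def)
  have slope: "dderiv d F u = m * dderiv b F u" if "u \<in> B" "dderiv c F u = m * dderiv a F u" for u m
  proof -
    have "dderiv a F u * dderiv d F u = dderiv a F u * (m * dderiv b F u)"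
      using null_frame_eikonal[OF fr F, of u] that(2) by (simp add: mult_ac)
    then show ?thesis using B(2)[OF that(1)] by simp
  qed
  \<comment> \<open>On isotropic vectors the polarized determinant splits, and one factor is the
    difference of the slopes; nonorthogonal gradients thus have different slopes.\<close>
  have "2 * bilinear_pairing (cgrad F x) (cgrad F y) = (\<mu> - \<mu>') *
      (dderiv b F x * dderiv a F y - dderiv a F x * dderiv b F y)"
    unfolding null_frame_pairing[OF fr] unfolding dderiv_cgrad[symmetric]
      slope[OF xy(1) c(1)] slope[OF xy(2) c(2)] c by (simp add: algebra_simps)
  then have ne: "\<mu> - \<mu>' \<noteq> 0" using xy(3) by auto
  obtain \<alpha> \<beta> \<gamma> \<delta> where h: "cvec (x - y) = \<alpha> *s a + \<beta> *s b + \<gamma> *s c + \<delta> *s d"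
    using null_frame_span[OF fr] by metis
  \<comment> \<open>Solves \<open>w2 = w1 + cvec (x - y)\<close>: the coefficients of
    \<open>c\<close> and \<open>d\<close> are matched by the shifts \<open>\<gamma>\<close> and
    \<open>\<delta>\<close>, those of \<open>a\<close> and \<open>b\<close> give these two
    equations.\<close>
  define \<sigma> \<tau> where "\<sigma> = (\<alpha> + \<mu>' * \<gamma>) / (\<mu> - \<mu>')" and "\<tau> = (\<beta> + \<mu>' * \<delta>) / (\<mu> - \<mu>')"
  have "\<sigma> * (\<mu> - \<mu>') = \<alpha> + \<mu>' * \<gamma>" "\<tau> * (\<mu> - \<mu>') = \<beta> + \<mu>' * \<delta>"
    using ne by (simp_all add: \<sigma>_def \<tau>_def)
  then have st: "\<sigma> * \<mu> - \<sigma> * \<mu>' = \<alpha> + \<mu>' * \<gamma>" "\<tau> * \<mu> - \<tau> * \<mu>' = \<beta> + \<mu>' * \<delta>"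
    by (simp_all only: right_diff_distrib)
  define w1 w2 where "w1 = \<sigma> *s (c - \<mu> *s a) + \<tau> *s (d - \<mu> *s b)"
    and "w2 = (\<sigma> + \<gamma>) *s (c - \<mu>' *s a) + (\<tau> + \<delta>) *s (d - \<mu>' *s b)"
  have "w2 = w1 + cvec (x - y)"
    unfolding h w1_def w2_def vec_eq_iff using st by (simp add: algebra_simps)
  moreover have "(dderiv w2 ^^ n) F y = 0" "(dderiv w1 ^^ n) F (y + (x - y)) = 0" if "n \<ge> 1" for n
    using dderiv_pow_null_plane[OF fr F B xy(2) c(2) w2_def that]
      dderiv_pow_null_plane[OF fr F B xy(1) c(1) w1_def that] by simp_all
  ultimately have "F (y + (x - y)) = F y"
    using F by (intro taylor_two_point) (auto simp: eigenfunction_def)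
  then show ?thesis by simp
qed

lemma open_cgrad_pairing_ne_zero:
  assumes "smooth F"
  shows "open {y. bilinear_pairing v (cgrad F y) \<noteq> 0}"
  using open_Collect_neq[OF smooth_continuous[OF smooth_dderiv[OF assms]] continuous_on_const, of v 0]
  by (simp add: dderiv_cgrad)

lemma dderiv_eq_0_of_locally_const:
  assumes "open U" "y \<in> U" "\<And>u. u \<in> U \<Longrightarrow> F u = k"
  shows "dderiv w F y = 0"
  using dderiv_cong_ev[OF assms(1,2), of F "\<lambda>_. k"] assms(3) by simp

text \<open>Fix \<open>x\<close> in \<open>B\<close>. On the open part of \<open>B\<close> where the
  gradient is not orthogonal to the one at \<open>x\<close>, \<open>F\<close> has the constant value
  \<open>F x\<close>, so its gradient there is zero, a contradiction. Unique continuation extends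
  orthogonality from \<open>B\<close> first in \<open>y\<close>, then in \<open>x\<close>.\<close>

lemma cgrad_isotropic_of_shear_free:
  assumes fr: "null_frame a b c d" and F: "eigenfunction F"
    and B: "open B" "\<And>y. y \<in> B \<Longrightarrow> dderiv a F y \<noteq> 0" "\<And>y. y \<in> B \<Longrightarrow> shear a c F y = 0"
    and ne: "u \<in> B"
  shows "bilinear_pairing (cgrad F x) (cgrad F y) = 0"
proof -
  have h: "harmonic F" and s: "smooth F" using F by (auto simp: eigenfunction_def harmonic_def)
  have local: "dderiv (cgrad F x) F y = 0" if x: "x \<in> B" and y: "y \<in> B" for x y
  proof (rule ccontr)
    assume "dderiv (cgrad F x) F y \<noteq> 0"
    let ?V = "B \<inter> {y. bilinear_pairing (cgrad F x) (cgrad F y) \<noteq> 0}"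
    have "open ?V" "y \<in> ?V"
      using B(1) y \<open>dderiv _ F y \<noteq> 0\<close> by (auto intro: open_cgrad_pairing_ne_zero s simp: dderiv_cgrad)
    moreover have "F v = F x" if "v \<in> ?V" for v
      using eq_of_pairing_ne_zero[OF fr F B x, of v] that by auto
    ultimately have "dderiv (cgrad F x) F y = 0" by (rule dderiv_eq_0_of_locally_const)
    then show False using \<open>dderiv _ F y \<noteq> 0\<close> by contradiction
  qed
  have one: "dderiv (cgrad F x) F y = 0" if "x \<in> B" for x y
    by (rule harmonic_unique_continuation[OF harmonic_dderiv[OF h] B(1) ne]) (rule local[OF that])
  have "dderiv (cgrad F y) F x = 0"
    by (rule harmonic_unique_continuation[OF harmonic_dderiv[OF h] B(1) ne])
       (use one in \<open>simp add: dderiv_cgrad bilinear_pairing_commute\<close>)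
  then show ?thesis by (simp add: dderiv_cgrad bilinear_pairing_commute)
qed

lemma cgrad_isotropic:
  fixes F :: "real^'m \<Rightarrow> complex"
  assumes "CARD('m) \<le> 4" and F: "eigenfunction F"
  shows "bilinear_pairing (cgrad F x) (cgrad F y) = 0"
proof (rule ccontr)
  assume ne: "bilinear_pairing (cgrad F x) (cgrad F y) \<noteq> 0"
  have s: "smooth F" using F by (auto simp: eigenfunction_def harmonic_def)
  obtain a b c d :: "complex^'m" where fr0: "null_frame a b c d"
    using null_frame_exists[OF assms(1)] by blast
  \<comment> \<open>Symmetries of the determinant that bring each of the other three frame vectors
    to the first place.\<close>
  have frames: "null_frame d b c a" "null_frame b a (- d) (- c)" "null_frame c d (- a) (- b)"
    using fr0 by (auto simp: null_frame_def algebra_simps)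
  have "dderiv a F x \<noteq> 0 \<or> dderiv b F x \<noteq> 0 \<or> dderiv c F x \<noteq> 0 \<or> dderiv d F x \<noteq> 0"
    using ne null_frame_pairing[OF fr0, of "cgrad F x" "cgrad F y"] by (auto simp: dderiv_cgrad)
  then obtain a b c d :: "complex^'m" where fr: "null_frame a b c d" and ax: "dderiv a F x \<noteq> 0"
    using fr0 frames by blast
  have fr': "null_frame a c b d"
    using fr by (simp add: null_frame_def algebra_simps)
  have op: "open {y. dderiv a F y \<noteq> 0}"
    using open_cgrad_pairing_ne_zero[OF s, of a] by (simp add: dderiv_cgrad)
  show False
  \<comment> \<open>If one shear is nonzero somewhere, it is nonzero on an open set, where the other
    must vanish; exchanging \<open>b\<close> and \<open>c\<close> exchanges the two families of
    planes.\<close>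
  proof (cases "\<forall>y. dderiv a F y \<noteq> 0 \<longrightarrow> shear a c F y = 0")
    case True
    then show False
      using cgrad_isotropic_of_shear_free[OF fr F op, of x x y] ax ne by auto
  next
    case False
    then obtain v where v: "dderiv a F v \<noteq> 0" "shear a c F v \<noteq> 0" by blast
    let ?B = "{y. dderiv a F y \<noteq> 0} \<inter> {y. shear a c F y \<noteq> 0}"
    have "continuous_on UNIV (shear a c F)"
      unfolding shear_def[abs_def]
      by (intro continuous_intros smooth_continuous smooth_dderiv s)
    then have "open {y. shear a c F y \<noteq> 0}"
      by (intro open_Collect_neq continuous_on_const)
    then have B: "open ?B" using op by blast
    have sh: "shear a b F y = 0" if "y \<in> ?B" for y
      using shear_product[OF fr F, of y] that by simp
    have "v \<in> ?B" using v by simp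
    with cgrad_isotropic_of_shear_free[OF fr' F B _ sh] ne show False by blast
  qed
qed

subsection \<open>Gradients of a family\<close>

lemma bilinear_pairing_add_left: "bilinear_pairing (u + v) w = bilinear_pairing u w + bilinear_pairing v w"
  by (simp add: bilinear_pairing_def distrib_right sum.distrib)

lemma bilinear_pairing_scale_left: "bilinear_pairing (c *s u) w = c * bilinear_pairing u w"
  by (simp add: bilinear_pairing_def sum_distrib_left mult_ac)

lemma bilinear_pairing_add_right: "bilinear_pairing w (u + v) = bilinear_pairing w u + bilinear_pairing w v"
  by (simp add: bilinear_pairing_def distrib_left sum.distrib)

lemma bilinear_pairing_scale_right: "bilinear_pairing w (c *s u) = c * bilinear_pairing w u"
  by (simp add: bilinear_pairing_def sum_distrib_left mult_ac)

lemmas bilinear_pairing_simps = bilinear_pairing_add_left bilinear_pairing_scale_left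
  bilinear_pairing_add_right bilinear_pairing_scale_right

lemma cgrad_add: "smooth F \<Longrightarrow> smooth G \<Longrightarrow> cgrad (\<lambda>x. F x + G x) x = cgrad F x + cgrad G x"
  by (simp add: cgrad_def vec_eq_iff partial_add smooth_differentiable)

lemma cgrad_mult:
  "smooth F \<Longrightarrow> smooth G \<Longrightarrow> cgrad (\<lambda>x. F x * G x) x = F x *s cgrad G x + G x *s cgrad F x"
  by (simp add: cgrad_def vec_eq_iff partial_mult smooth_differentiable)

lemma harmonic_mult:
  assumes "harmonic F" "harmonic G" "\<And>x. bilinear_pairing (cgrad F x) (cgrad G x) = 0"
  shows "harmonic (\<lambda>x. F x * G x)"
proof -
  have s: "smooth F" "smooth G" using assms by (auto simp: harmonic_def)
  have "laplacian (\<lambda>x. F x * G x) x = F x * laplacian G x + 2 * bilinear_pairing (cgrad F x) (cgrad G x)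
      + laplacian F x * G x" for x
    by (simp add: laplacian_def partial2_mult s bilinear_pairing_def cgrad_def sum.distrib
        sum_distrib_left sum_distrib_right mult_ac)
  then show ?thesis using assms by (simp add: harmonic_def smooth_mult)
qed

lemma cgrad_pairing_antisym:
  fixes F G :: "real^'m \<Rightarrow> complex"
  assumes m: "CARD('m) \<le> 4" and F: "eigenfunction F" and G: "eigenfunction G"
    and FG: "\<And>x. bilinear_pairing (cgrad F x) (cgrad G x) = 0"
  shows "bilinear_pairing (cgrad F x) (cgrad G y) + bilinear_pairing (cgrad G x) (cgrad F y) = 0"
proof -
  have s: "smooth F" "smooth G" using F G by (auto simp: eigenfunction_def harmonic_def)
  have "eigenfunction (\<lambda>x. F x + G x)"
    using F G FG by (simp add: eigenfunction_def harmonic_add cgrad_add s bilinear_pairing_simps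
        bilinear_pairing_commute[of "cgrad G _" "cgrad F _"])
  from cgrad_isotropic[OF m this, of x y] show ?thesis
    using cgrad_isotropic[OF m F, of x y] cgrad_isotropic[OF m G, of x y]
    by (simp add: cgrad_add s bilinear_pairing_simps add.commute)
qed

text \<open>Antisymmetry for the pairs \<open>(F, G)\<close> and \<open>(F, F G)\<close> together gives
  \<open>(F y - F x) \<langle>\<nabla>F x, \<nabla>G y\<rangle> = 0\<close>.\<close>

lemma cgrad_pairing_zero:
  fixes F G :: "real^'m \<Rightarrow> complex"
  assumes m: "CARD('m) \<le> 4" and F: "eigenfunction F" and G: "eigenfunction G"
    and FG: "\<And>x. bilinear_pairing (cgrad F x) (cgrad G x) = 0"
  shows "bilinear_pairing (cgrad F x) (cgrad G y) = 0"
proof (rule ccontr)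
  assume ne: "bilinear_pairing (cgrad F x) (cgrad G y) \<noteq> 0"
  have s: "smooth F" "smooth G" using F G by (auto simp: eigenfunction_def harmonic_def)
  have FF: "bilinear_pairing (cgrad F x) (cgrad F x) = 0" "bilinear_pairing (cgrad G x) (cgrad G x) = 0" for x
    using F G by (auto simp: eigenfunction_def)
  let ?H = "\<lambda>x. F x * G x"
  have H: "eigenfunction ?H"
    using F G FG FF unfolding eigenfunction_def
    by (simp add: harmonic_mult cgrad_mult s bilinear_pairing_simps
        bilinear_pairing_commute[of "cgrad G _" "cgrad F _"])
  have FH: "bilinear_pairing (cgrad F x) (cgrad ?H x) = 0" for x
    by (simp add: cgrad_mult s bilinear_pairing_simps FG FF)
  have eq: "(F y - F u) * bilinear_pairing (cgrad F u) (cgrad G y) = 0" for u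
    using cgrad_pairing_antisym[OF m F G FG, of u y] cgrad_pairing_antisym[OF m F H FH, of u y]
      cgrad_isotropic[OF m F, of u y]
    by (simp add: cgrad_mult s bilinear_pairing_simps) algebra
  \<comment> \<open>By \<open>eq\<close>, \<open>F\<close> is constant on this open set, so its
    gradient is zero there.\<close>
  let ?V = "{u. bilinear_pairing (cgrad G y) (cgrad F u) \<noteq> 0}"
  have "open ?V" by (rule open_cgrad_pairing_ne_zero[OF s(1)])
  moreover have "x \<in> ?V" using ne by (simp add: bilinear_pairing_commute)
  moreover have "F u = F y" if "u \<in> ?V" for u
    using eq[of u] that by (simp add: bilinear_pairing_commute)
  ultimately have "dderiv (cgrad G y) F x = 0" by (rule dderiv_eq_0_of_locally_const)
  then show False using ne by (simp add: dderiv_cgrad bilinear_pairing_commute)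
qed

lemma eigenfamily_gradients_isotropic:
  fixes \<F> :: "(real^'m \<Rightarrow> complex) set"
  assumes m: "CARD('m) \<le> 4" and fam: "zero_zero_eigenfamily \<F>" and FG: "F \<in> \<F>" "G \<in> \<F>"
  shows "bilinear_pairing (cgrad F x) (cgrad G y) = 0"
proof -
  have eig: "eigenfunction H" if "H \<in> \<F>" for H
    using fam that by (auto simp: zero_zero_eigenfamily_def eigenfunction_def harmonic_def complex_gradient_eq)
  have s: "smooth F" "smooth G" using fam FG by (auto simp: zero_zero_eigenfamily_def)
  have "bilinear_pairing (complex_gradient F x) (complex_gradient G x) = 0" for x
    using fam FG by (simp add: zero_zero_eigenfamily_def)
  then have "bilinear_pairing (cgrad F x) (cgrad G x) = 0" for x
    by (simp add: complex_gradient_eq s)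
  then show ?thesis by (rule cgrad_pairing_zero[OF m eig[OF FG(1)] eig[OF FG(2)]])
qed

subsection \<open>Unitary bases of isotropic subspaces\<close>

definition herm :: "complex^'m \<Rightarrow> complex^'m \<Rightarrow> complex" where
  "herm v w = (\<Sum>i\<in>UNIV. v $ i * cnj (w $ i))"

lemma herm_simps:
  "herm (u + v) w = herm u w + herm v w" "herm (u - v) w = herm u w - herm v w"
  "herm (c *s u) w = c * herm u w" "herm w (c *s u) = cnj c * herm w u"
  by (simp_all add: herm_def sum.distrib sum_subtractf sum_distrib_left algebra_simps)

lemma herm_sum: "herm (\<Sum>j\<in>A. g j) w = (\<Sum>j\<in>A. herm (g j) w)"
  by (induction A rule: infinite_finite_induct) (auto simp: herm_simps herm_def[of 0])

lemma herm_commute: "herm w v = cnj (herm v w)"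
  by (simp add: herm_def mult.commute)

lemma Re_herm: "Re (herm v w) = v \<bullet> w"
  by (simp add: herm_def inner_vec_def inner_complex_def)

lemma herm_self: "herm v v = complex_of_real ((norm v)\<^sup>2)"
proof (rule complex_eqI)
  show "Re (herm v v) = Re (complex_of_real ((norm v)\<^sup>2))"
    by (simp add: Re_herm power2_norm_eq_inner)
  show "Im (herm v v) = Im (complex_of_real ((norm v)\<^sup>2))"
    by (simp add: herm_def complex_mult_cnj)
qed

text \<open>Squared length \<open>2\<close> makes the real and imaginary parts of isotropic vectors unit vectors.\<close>

definition unitary_family :: "(complex^'m) set \<Rightarrow> nat \<Rightarrow> (nat \<Rightarrow> complex^'m) \<Rightarrow> bool" where
  "unitary_family S k z \<longleftrightarrow> (\<forall>j<k. z j \<in> S) \<and>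
     (\<forall>i<k. \<forall>j<k. herm (z i) (z j) = (if i = j then 2 else 0))"

text \<open>A unitary family of maximal length replaces Gram-Schmidt: a nonzero remainder of a
  vector of \<open>S\<close> after projection could be rescaled and appended.\<close>

lemma unitary_basis_exists:
  fixes P :: "(complex^'m) set"
  defines "S \<equiv> vec.span P"
  shows "\<exists>k z. unitary_family S k z \<and> (\<forall>v\<in>S. v = (\<Sum>j<k. (herm v (z j) / 2) *s z j))"
proof -
  \<comment> \<open>The real part of \<open>herm\<close> is the real inner product, so unitary
    families are orthogonal over the reals and the real dimension bounds their length.\<close>
  have "k < Suc DIM(complex^'m)" if "unitary_family S k z" for k z
  proof -
    have in2: "z i \<bullet> z j = (if i = j then 2 else 0)" if "i < k" "j < k" for i j
      using \<open>unitary_family S k z\<close> that by (simp add: unitary_family_def flip: Re_herm)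
    have inj: "inj_on z {..<k}"
      by (rule inj_onI) (metis in2 lessThan_iff zero_neq_numeral)
    have "pairwise orthogonal (z ` {..<k})"
      by (auto simp: pairwise_def orthogonal_def in2 split: if_splits)
    moreover have "0 \<notin> z ` {..<k}"
      using in2 by (metis imageE inner_zero_left lessThan_iff zero_neq_numeral)
    ultimately have "independent (z ` {..<k})" by (rule pairwise_orthogonal_independent)
    then have "card (z ` {..<k}) \<le> DIM(complex^'m)" using independent_bound by blast
    then show ?thesis by (simp add: card_image[OF inj])
  qed
  then have bd: "\<forall>k. (\<exists>z. unitary_family S k z) \<longrightarrow> k < Suc DIM(complex^'m)" by blast
  have "\<exists>z. unitary_family S 0 z" by (simp add: unitary_family_def)
  from ex_has_greatest_nat[of "\<lambda>k. \<exists>z. unitary_family S k z" 0 "\<lambda>k. k", OF this bd]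
  obtain k z where fam: "unitary_family S k z" and max: "\<And>l w. unitary_family S l w \<Longrightarrow> l \<le> k" by blast
  then have Q: "(\<forall>j<k. z j \<in> S) \<and> (\<forall>i<k. \<forall>j<k. herm (z i) (z j) = (if i = j then 2 else 0))"
    by (simp add: unitary_family_def)
  have "v = (\<Sum>j<k. (herm v (z j) / 2) *s z j)" if v: "v \<in> S" for v
  proof (rule ccontr)
    define r where "r = v - (\<Sum>j<k. (herm v (z j) / 2) *s z j)"
    assume "v \<noteq> (\<Sum>j<k. (herm v (z j) / 2) *s z j)"
    then have "norm r > 0" by (simp add: r_def)
    have r: "r \<in> S"
      unfolding r_def S_def using v Q
      by (intro vec.span_diff vec.span_sum vec.span_scale) (auto simp: S_def)
    have orth: "herm r (z l) = 0" if "l < k" for l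
    proof -
      have "(\<Sum>j<k. herm v (z j) / 2 * herm (z j) (z l)) = (\<Sum>j<k. if j = l then herm v (z j) else 0)"
        using Q that by (intro sum.cong) auto
      then show ?thesis using that by (simp add: r_def herm_simps herm_sum)
    qed
    define c where "c = complex_of_real (sqrt 2 / norm r)"
    have "herm (c *s r) (c *s r) = c * (cnj c * herm r r)"
      by (simp only: herm_simps mult.left_commute)
    also have "\<dots> = complex_of_real (sqrt 2 / norm r * (sqrt 2 / norm r * (norm r)\<^sup>2))"
      by (simp only: c_def complex_cnj_complex_of_real herm_self of_real_mult)
    also have "sqrt 2 / norm r * (sqrt 2 / norm r * (norm r)\<^sup>2) = 2"
      using \<open>norm r > 0\<close> by (simp add: power2_eq_square)
    finally have new: "herm (c *s r) (c *s r) = 2" by simp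
    have old: "herm (z l) (c *s r) = 0" "herm (c *s r) (z l) = 0" if "l < k" for l
      by (simp_all add: herm_simps orth[OF that] herm_commute[of "z l" r])
    have cr: "c *s r \<in> S" using r unfolding S_def by (rule vec.span_scale)
    have "unitary_family S (Suc k) (\<lambda>j. if j = k then c *s r else z j)"
      unfolding unitary_family_def
    proof (intro conjI allI impI)
      show "(if j = k then c *s r else z j) \<in> S" if "j < Suc k" for j
        using that Q cr by (cases "j = k") auto
      show "herm (if i = k then c *s r else z i) (if j = k then c *s r else z j) = (if i = j then 2 else 0)"
        if "i < Suc k" "j < Suc k" for i j
        using that Q new old[of i] old[of j] by (cases "i = k"; cases "j = k") simp_all
    qed
    then show False using max[of "Suc k"] by fastforce
  qed
  with fam show ?thesis by blast
qed

section \<open>The projection and the holomorphic factorization\<close>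

theorem theorem4:
  fixes \<F> :: "(real^'m \<Rightarrow> complex) set"
  assumes "CARD('m) \<le> 4"
    and "zero_zero_eigenfamily \<F>"
  shows "uniformly_of_complex_type \<F>"
proof -
  \<comment> \<open>Gradients at all points are collected, since one projection has to serve every
    point and every member of the family.\<close>
  define P where "P = {cgrad F x | F x. F \<in> \<F>}"
  have PP: "bilinear_pairing p q = 0" if "p \<in> P" "q \<in> P" for p q
    using that eigenfamily_gradients_isotropic[OF assms] by (auto simp: P_def)
  have z0: "bilinear_pairing 0 q = 0" for q :: "complex^'m" by (simp add: bilinear_pairing_def)
  have SP: "bilinear_pairing v q = 0" if "v \<in> vec.span P" "q \<in> P" for v q
    using that(1) by (induction rule: vec.span_induct_alt) (auto simp: bilinear_pairing_simps z0 PP that)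
  have iso: "bilinear_pairing v w = 0" if "v \<in> vec.span P" "w \<in> vec.span P" for v w
    using that(2) by (induction rule: vec.span_induct_alt)
      (simp_all add: bilinear_pairing_simps SP[OF that(1)] z0 bilinear_pairing_commute[of v 0])
  obtain k z where fam: "unitary_family (vec.span P) k z"
    and basis: "\<And>v. v \<in> vec.span P \<Longrightarrow> v = (\<Sum>j<k. (herm v (z j) / 2) *s z j)"
    using unitary_basis_exists[of P] by blast
  have z: "z j \<in> vec.span P" if "j < k" for j
    using fam that by (simp add: unitary_family_def)
  have zz: "herm (z i) (z j) = (if i = j then 2 else 0)" if "i < k" "j < k" for i j
    using fam that by (simp add: unitary_family_def)
  define a b :: "nat \<Rightarrow> real^'m" where "a = (\<lambda>j. \<chi> i. Re (z j $ i))" and "b = (\<lambda>j. \<chi> i. Im (z j $ i))"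
  \<comment> \<open>\<open>herm\<close> yields the sum and \<open>bilinear_pairing\<close> the
    difference of the inner products of real parts and of imaginary parts, and similarly for the
    mixed ones; isotropy therefore makes these \<open>2 * k\<close> vectors orthonormal.\<close>
  have ab: "a i \<bullet> a j = (if i = j then 1 else 0)" "b i \<bullet> b j = (if i = j then 1 else 0)"
    "a i \<bullet> b j = 0" "b i \<bullet> a j = 0" if ij: "i < k" "j < k" for i j
  proof -
    have "Re (herm (z i) (z j)) = a i \<bullet> a j + b i \<bullet> b j" "Im (herm (z i) (z j)) = b i \<bullet> a j - a i \<bullet> b j"
      "Re (bilinear_pairing (z i) (z j)) = a i \<bullet> a j - b i \<bullet> b j"
      "Im (bilinear_pairing (z i) (z j)) = a i \<bullet> b j + b i \<bullet> a j"
      by (simp_all add: herm_def bilinear_pairing_def inner_vec_def a_def b_def sum.distrib sum_subtractf)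
    then have "a i \<bullet> a j + b i \<bullet> b j = (if i = j then 2 else 0)" "b i \<bullet> a j - a i \<bullet> b j = 0"
      "a i \<bullet> a j - b i \<bullet> b j = 0" "a i \<bullet> b j + b i \<bullet> a j = 0"
      using zz[OF ij] iso[OF z[OF ij(1)] z[OF ij(2)]] by (auto split: if_splits)
    then show "a i \<bullet> a j = (if i = j then 1 else 0)" "b i \<bullet> b j = (if i = j then 1 else 0)"
      "a i \<bullet> b j = 0" "b i \<bullet> a j = 0" by (auto split: if_splits)
  qed
  define \<iota> :: "(nat \<Rightarrow> complex) \<Rightarrow> real^'m" where "\<iota> = (\<lambda>\<zeta>. \<Sum>j<k. Re (\<zeta> j) *\<^sub>R a j + Im (\<zeta> j) *\<^sub>R b j)"
  define \<pi> :: "real^'m \<Rightarrow> nat \<Rightarrow> complex" where "\<pi> = (\<lambda>x j. if j < k then Complex (x \<bullet> a j) (x \<bullet> b j) else 0)"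
  have \<pi>_space: "\<pi> x \<in> complex_space k" for x by (simp add: \<pi>_def complex_space_def)
  have \<pi>_adj: "complex_space_inner k (\<pi> x) \<zeta> = x \<bullet> \<iota> \<zeta>" for x \<zeta>
    by (simp add: complex_space_inner_def \<pi>_def \<iota>_def inner_sum_right inner_add_right inner_complex_def mult.commute)
  have \<pi>\<iota>: "\<pi> (\<iota> \<zeta>) l = \<zeta> l" if "l < k" for \<zeta> l
  proof -
    have "\<iota> \<zeta> \<bullet> a l = (\<Sum>j<k. if j = l then Re (\<zeta> j) else 0)" "\<iota> \<zeta> \<bullet> b l = (\<Sum>j<k. if j = l then Im (\<zeta> j) else 0)"
      unfolding \<iota>_def inner_sum_left
      by (rule sum.cong[OF refl], simp add: inner_add_left ab that)+
    then show ?thesis using that by (simp add: \<pi>_def complex_eq_iff)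
  qed
  have \<pi>_diff: "\<pi> (x - y) l = \<pi> x l - \<pi> y l" for x y l
    by (simp add: \<pi>_def inner_diff_left complex_eq_iff)
  have \<iota>_add: "\<iota> (\<lambda>j. u j + v j) = \<iota> u + \<iota> v" for u v
    by (simp add: \<iota>_def scaleR_left_distrib sum.distrib algebra_simps)
  have \<iota>_norm: "norm (\<iota> \<zeta>) = complex_space_norm k \<zeta>" for \<zeta>
  proof -
    have "\<iota> \<zeta> \<bullet> \<iota> \<zeta> = (\<Sum>j<k. (cmod (\<zeta> j))\<^sup>2)"
      unfolding \<pi>_adj[symmetric] complex_space_inner_def
      by (intro sum.cong refl) (simp add: \<pi>\<iota> power2_norm_eq_inner)
    then show ?thesis by (simp add: norm_eq_sqrt_inner complex_space_norm_def L2_set_def)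
  qed
  have "\<iota> (\<lambda>j. c *\<^sub>R \<zeta> j) = c *\<^sub>R \<iota> \<zeta>" for c :: real and \<zeta>
    by (simp add: \<iota>_def scaleR_sum_right scaleR_right_distrib)
  then have "isometric_linear_embedding k \<iota>"
    by (simp add: isometric_linear_embedding_def \<iota>_add \<iota>_norm)
  then have proj: "orthogonal_projection k \<pi>"
    using \<pi>_space \<pi>_adj unfolding orthogonal_projection_def by blast
  \<comment> \<open>Pairing with \<open>z j\<close> reads off the coordinates of
    \<open>\<pi>\<close>, so a gradient in the span gives a differential that is complex linear in
    \<open>\<pi> h\<close>.\<close>
  have z_pair: "bilinear_pairing (z j) (cvec x) = \<pi> x j" if "j < k" for j x
    using that by (simp add: bilinear_pairing_def cvec_def \<pi>_def complex_eq_iff inner_vec_def a_def b_def mult.commute)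
  have smooth: "smooth F" if "F \<in> \<F>" for F using assms(2) that by (simp add: zero_zero_eigenfamily_def)
  have deriv: "\<exists>c. \<forall>h. dderiv (cvec h) F x = (\<Sum>j<k. c j * \<pi> h j)" if "F \<in> \<F>" for F x
  proof -
    have "cgrad F x \<in> vec.span P" using that by (auto simp: P_def intro: vec.span_base)
    then have grad: "cgrad F x = (\<Sum>j<k. (herm (cgrad F x) (z j) / 2) *s z j)" by (rule basis)
    have sum: "bilinear_pairing (\<Sum>j\<in>A. g j) w = (\<Sum>j\<in>A. bilinear_pairing (g j) w)"
      for A and g :: "nat \<Rightarrow> complex^'m" and w
      by (induction A rule: infinite_finite_induct) (auto simp: bilinear_pairing_simps z0)
    have "dderiv (cvec h) F x = (\<Sum>j<k. herm (cgrad F x) (z j) / 2 * \<pi> h j)" for h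
      unfolding dderiv_cgrad bilinear_pairing_commute[of "cvec h"]
      by (subst grad) (simp add: sum bilinear_pairing_simps z_pair)
    then show ?thesis by (intro exI[of _ "\<lambda>j. herm (cgrad F x) (z j) / 2"] allI)
  qed
  \<comment> \<open>\<open>x\<close> and \<open>\<iota> (\<pi> x)\<close> differ by a vector in the
    kernel of \<open>\<pi>\<close>, along which \<open>F\<close> has zero derivative
    everywhere.\<close>
  have factor: "F x = F (\<iota> (\<pi> x))" if F: "F \<in> \<F>" for F x
  proof -
    let ?n = "x - \<iota> (\<pi> x)"
    have "\<pi> ?n j = 0" for j
      by (cases "j < k") (simp add: \<pi>_diff \<pi>\<iota>, simp add: \<pi>_def)
    then have zero: "dderiv (cvec ?n) F y = 0" for y using deriv[OF F, of y] by auto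
    have line: "((\<lambda>t. F (\<iota> (\<pi> x) + t *\<^sub>R ?n)) has_derivative (\<lambda>s. 0)) (at t)" for t
      using dderiv_line[OF smooth[OF F], of "\<iota> (\<pi> x)" ?n t] by (simp add: zero has_vector_derivative_def)
    have "\<exists>t\<in>{0<..<1::real}. norm (F (\<iota> (\<pi> x) + 1 *\<^sub>R ?n) - F (\<iota> (\<pi> x) + 0 *\<^sub>R ?n)) \<le> norm ((\<lambda>s::real. 0::complex) (1 - 0))"
      by (intro mvt_general line continuous_at_imp_continuous_on ballI has_derivative_continuous[OF line]) simp
    then show ?thesis by simp
  qed
  have holo: "holomorphic_map k (F \<circ> \<iota>)" if F: "F \<in> \<F>" for F
    unfolding holomorphic_map_def
  proof (intro ballI)
    fix \<zeta> assume "\<zeta> \<in> complex_space k"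
    obtain c where c: "\<And>h. dderiv (cvec h) F (\<iota> \<zeta>) = (\<Sum>j<k. c j * \<pi> h j)" using deriv[OF F] by blast
    have "(F has_derivative (\<lambda>h. dderiv (cvec h) F (\<iota> \<zeta>))) (at (\<iota> \<zeta>))"
      using has_derivative_sum_partial[OF smooth_differentiable[OF smooth[OF F]], of "\<iota> \<zeta>"]
      by (simp add: dderiv_def cvec_def scaleR_conv_of_real[where 'a = complex])
    then have alt: "\<forall>e>0. \<exists>d>0. \<forall>y. norm (y - \<iota> \<zeta>) < d \<longrightarrow>
        norm (F y - F (\<iota> \<zeta>) - dderiv (cvec (y - \<iota> \<zeta>)) F (\<iota> \<zeta>)) \<le> e * norm (y - \<iota> \<zeta>)"
      unfolding has_derivative_at_alt by blast
    show "\<exists>c. \<forall>\<epsilon>>0. \<exists>\<delta>>0. \<forall>h\<in>complex_space k. complex_space_norm k h < \<delta> \<longrightarrow>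
       cmod ((F \<circ> \<iota>) (\<lambda>j. \<zeta> j + h j) - (F \<circ> \<iota>) \<zeta> - (\<Sum>j<k. c j * h j)) \<le> \<epsilon> * complex_space_norm k h"
    proof (intro exI[of _ c] allI impI)
      fix \<epsilon> :: real assume "\<epsilon> > 0"
      with alt obtain \<delta> where "\<delta> > 0" and \<delta>: "\<And>y. norm (y - \<iota> \<zeta>) < \<delta> \<Longrightarrow>
        norm (F y - F (\<iota> \<zeta>) - dderiv (cvec (y - \<iota> \<zeta>)) F (\<iota> \<zeta>)) \<le> \<epsilon> * norm (y - \<iota> \<zeta>)" by blast
      show "\<exists>\<delta>>0. \<forall>h\<in>complex_space k. complex_space_norm k h < \<delta> \<longrightarrow>
         cmod ((F \<circ> \<iota>) (\<lambda>j. \<zeta> j + h j) - (F \<circ> \<iota>) \<zeta> - (\<Sum>j<k. c j * h j)) \<le> \<epsilon> * complex_space_norm k h"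
      proof (intro exI[of _ \<delta>] conjI ballI impI \<open>\<delta> > 0\<close>)
        fix h assume "complex_space_norm k h < \<delta>"
        moreover have "(\<Sum>j<k. c j * \<pi> (\<iota> h) j) = (\<Sum>j<k. c j * h j)" by (simp add: \<pi>\<iota>)
        ultimately show "cmod ((F \<circ> \<iota>) (\<lambda>j. \<zeta> j + h j) - (F \<circ> \<iota>) \<zeta> - (\<Sum>j<k. c j * h j))
            \<le> \<epsilon> * complex_space_norm k h"
          using \<delta>[of "\<iota> \<zeta> + \<iota> h"] by (simp add: \<iota>_add \<iota>_norm c)
      qed
    qed
  qed
  have comp: "F \<circ> \<iota> \<circ> \<pi> = F" if "F \<in> \<F>" for F
    using factor[OF that] by (simp add: fun_eq_iff)
  have "\<F> = {G \<circ> \<pi> | G. G \<in> (\<lambda>F. F \<circ> \<iota>) ` \<F>}"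
    using comp by (auto simp: image_iff) (metis comp)
  moreover have "\<forall>G \<in> (\<lambda>F. F \<circ> \<iota>) ` \<F>. holomorphic_map k G"
    using holo by blast
  ultimately show ?thesis
    unfolding uniformly_of_complex_type_def using proj by blast
qed

end
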